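(* Let $M$ be a locally compact Polish space with a positive, locally finite Borel measure $\mu$ of full topological support, and let $\{U_t:t\ge 0\}$ be a strongly continuous semigroup of bounded, positivity preserving linear operators on $L^2(M,\mu)$ with adjoint semigroup $\{U_t^*:t\ge 0\}$, both given for $t>0$ by a real-valued measurable kernel $u_t(x,y)$. Fix $t_0>0$ and assume: every $U_t$, $t>0$, is compact on $L^2(M,\mu)$; $U_{t_0}$ is positivity improving; both semigroups have the strong Feller property; and $U_{t_0},U_{t_0}^*:L^2(M,\mu)\to L^\infty(M,\mu)$ are bounded. Let $\phi_0,\psi_0,\mathcal N,\gamma,m,m^*$ be as defined in the context, and assume that there exists some $t_1\ge t_0$ such that the heat content satisfies $Z(t_1)<\infty$. (a) For every $p\in[1,\infty]$ there is a constant $C>0$ such that for every $f\in L^p(M,\mu)$ with $\|f\|_p\le 1$, all $t>6t_1$ and all $x\in M\setminus\mathcal N$, $$\left|\frac{U_tf(x)}{U_t\mathbf 1_M(x)}-m(f)\right|\le C\,e^{-\gamma t}\,\frac{U_{t_1}\mathbf 1_M(x)}{\phi_0(x)}\quad\text{and}\quad \left|\frac{U_t^*f(x)}{U_t^*\mathbf 1_M(x)}-m^*(f)\right|\le C\,e^{-\gamma t}\,\frac{U_{t_1}^*\mathbf 1_M(x)}{\psi_0(x)}.$$ Moreover, $m$ and $m^*$ are the only quasi-stationary measures of $\{U_t\}$ and $\{U_t^*\}$, respectively, with $m(M\setminus\mathcal N)\cdot m^*(M\setminus\mathcal N)>0$ (if $\bar m,\bar m^*$ are quasi-stationary probability measures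 of $\{U_t\}$, $\{U_t^*\}$ with $\bar m(M\setminus\mathcal N)\cdot\bar m^*(M\setminus\mathcal N)>0$, then $\bar m=m$, $\bar m^*=m^*$). (b) The exponential quasi-ergodicity in (a) is uniform on compact subsets of $M\setminus\mathcal N$: for every $p\in[1,\infty]$ and every compact $K\subset M\setminus\mathcal N$ there is $C_K>0$ such that for all $t>6t_1$ $$\sup_{x\in K}\sup_{\|f\|_p\le 1}\left|\frac{U_tf(x)}{U_t\mathbf 1_M(x)}-m(f)\right|\le C_Ke^{-\gamma t},\qquad \sup_{x\in K}\sup_{\|f\|_p\le 1}\left|\frac{U_t^*f(x)}{U_t^*\mathbf 1_M(x)}-m^*(f)\right|\le C_Ke^{-\gamma t}.$$
   Context: Neither compactness of $M$ nor finiteness of $\mu$ is assumed. For a measure $\sigma$ write $\sigma(g)=\int g\,d\sigma$; $\mathbf 1_M$ is the constant function $1$; $\|\cdot\|_p$ is the $L^p(M,\mu)$ norm. Kernels: $U_tf(x)=\int u_t(x,y)f(y)\,\mu(dy)$ and $U_t^*g(y)=\int u_t(x,y)g(x)\,\mu(dx)$, $t>0$; these formulas also define $U_t,U_t^*$ on other $L^p$ spaces. Positivity preserving: $f\ge0$ a.e. implies $U_tf\ge 0$ a.e. Positivity improving: $f\ge 0$, $f\not\equiv 0$ in $L^2$ implies $U_{t_0}f>0$ $\mu$-a.e. Strong Feller property: for every $t>0$ and $f\in L^\infty(M,\mu)$ one has $U_tf,U_t^*f\in C_b(M)$. Under the assumptions $U_t,U_t^*$ map $L^p(M,\mu)$ into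 $C_b(M)$ for all $t>2t_0$, $p\in[1,\infty]$; $U_tf$, $U_t^*f$ are always understood as these continuous functions. Ground states: with $A$ the generator of $\{U_t\}$ and $A^*$ that of $\{U_t^*\}$, $\lambda_0:=\inf\mathrm{Re}(\mathrm{Spec}(-A))=\inf\mathrm{Re}(\mathrm{Spec}(-A^* ))$ is a joint isolated simple eigenvalue of $-A$ and $-A^*$, with $L^2$-normalized, $\mu$-a.e. strictly positive eigenfunctions $\phi_0$ (of $-A$) and $\psi_0$ (of $-A^*$), so $U_t\phi_0=e^{-\lambda_0t}\phi_0$, $U_t^*\psi_0=e^{-\lambda_0t}\psi_0$; they have continuous bounded versions, which are used. Set $\Lambda:=\int\phi_0\psi_0\,d\mu$ and $\mathcal N:=\{\phi_0=0\}\cup\{\psi_0=0\}$ (a closed $\mu$-null set). The constant $\gamma$: under the assumptions there are constants $C_0,\gamma>0$ (known result) such that $|e^{\lambda_0t}u_t(x,y)-\Lambda^{-1}\phi_0(x)\psi_0(y)|\le C_0e^{-\gamma t}$ for all $t>2t_0$ and $\mu\otimes\mu$-a.a. $(x,y)$; such a $\gamma$ is fixed. Heat content: $Z(t):=\int U_t\mathbf 1_M\,d\mu=\int U_t^*\mathbf 1_M\,d\mu\in(0,\infty]$. If $Z(t_1)<\infty$ for some $t_1\ge t_0$, then $\phi_0,\psi_0\in L^1(M,\mu)$ and one defines the probability measures $m(E)=\int_E\psi_0\,d\mu/\int_M\psi_0\,d\mu$ and $m^*(E)=\int_E\phi_0\,d\mu/\int_M\phi_0\,d\mu$. Quasi-stationary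 measure: a probability measure $\bar m$ on the Borel sets of $M$ is quasi-stationary for $\{U_t\}$ if for all $t>0$ and $f\in L^\infty(M,\mu)$ we have $\bar m(U_t\mathbf 1_M)>0$ and $\bar m(U_tf)/\bar m(U_t\mathbf 1_M)=\bar m(f)$; analogously for $\{U_t^*\}$. *)

theory Defs
  imports "HOL-Probability.Probability"
begin

section \<open>\<open>L\<^sup>p\<close> spaces\<close>

text \<open>
  Elements of \<open>L\<^sup>p(M, \<mu>)\<close> are represented by measurable functions, and equality in \<open>L\<^sup>p\<close> is
  equality almost everywhere. The exponent ranges over \<open>[1, \<infinity>]\<close>; \<open>Lp_norm\<close> is meaningful on
  \<open>Lp_space\<close> only.
\<close>

definition Lp_space :: "'a measure \<Rightarrow> ennreal \<Rightarrow> ('a \<Rightarrow> 'b::{banach,second_countable_topology}) set" where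
  "Lp_space \<mu> p = {f \<in> borel_measurable \<mu>.
     if p = \<infinity> then esssup \<mu> (\<lambda>x. ereal (norm (f x))) < \<infinity>
     else integrable \<mu> (\<lambda>x. norm (f x) powr enn2real p)}"

definition Lp_norm :: "'a measure \<Rightarrow> ennreal \<Rightarrow> ('a \<Rightarrow> 'b::{banach,second_countable_topology}) \<Rightarrow> real" where
  "Lp_norm \<mu> p f =
     (if p = \<infinity> then real_of_ereal (esssup \<mu> (\<lambda>x. ereal (norm (f x))))
      else (LINT x|\<mu>. norm (f x) powr enn2real p) powr (1 / enn2real p))"

section \<open>Measures on the state space\<close>

definition locally_finite_measure :: "'a::topological_space measure \<Rightarrow> bool" where
  "locally_finite_measure \<mu> \<longleftrightarrow> (\<forall>x. \<exists>V. open V \<and> x \<in> V \<and> emeasure \<mu> V < \<infinity>)"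

definition full_support :: "'a::topological_space measure \<Rightarrow> bool" where
  "full_support \<mu> \<longleftrightarrow> (\<forall>V. open V \<longrightarrow> V \<noteq> {} \<longrightarrow> emeasure \<mu> V > 0)"

section \<open>Kernel operators\<close>

definition kernel_op ::
    "'a measure \<Rightarrow> ('a \<Rightarrow> 'a \<Rightarrow> real) \<Rightarrow> ('a \<Rightarrow> 'b::{banach,second_countable_topology}) \<Rightarrow> 'a \<Rightarrow> 'b" where
  "kernel_op \<mu> k f x = (LINT y|\<mu>. k x y *\<^sub>R f y)"

text \<open>
  The Bochner integral of a non-integrable function is \<open>0\<close>, so convergence of the integral
  defining \<open>kernel_op\<close> has to be required separately.
\<close>

definition kernel_integrable ::
    "'a measure \<Rightarrow> ('a \<Rightarrow> 'a \<Rightarrow> real) \<Rightarrow> ('a \<Rightarrow> 'b::{banach,second_countable_topology}) \<Rightarrow> bool" where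
  "kernel_integrable \<mu> k f \<longleftrightarrow> (AE x in \<mu>. integrable \<mu> (\<lambda>y. k x y *\<^sub>R f y))"

definition adj_kernel :: "(real \<Rightarrow> 'a \<Rightarrow> 'a \<Rightarrow> real) \<Rightarrow> real \<Rightarrow> 'a \<Rightarrow> 'a \<Rightarrow> real" where
  "adj_kernel u t x y = u t y x"

definition L2_bounded :: "'a measure \<Rightarrow> ('a \<Rightarrow> 'a \<Rightarrow> real) \<Rightarrow> bool" where
  "L2_bounded \<mu> k \<longleftrightarrow>
     (\<exists>C. \<forall>f::'a \<Rightarrow> complex. f \<in> Lp_space \<mu> 2 \<longrightarrow>
        kernel_integrable \<mu> k f \<and> kernel_op \<mu> k f \<in> Lp_space \<mu> 2 \<and>
        Lp_norm \<mu> 2 (kernel_op \<mu> k f) \<le> C * Lp_norm \<mu> 2 f)"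

definition L2_adjoint :: "'a measure \<Rightarrow> ('a \<Rightarrow> 'a \<Rightarrow> real) \<Rightarrow> ('a \<Rightarrow> 'a \<Rightarrow> real) \<Rightarrow> bool" where
  "L2_adjoint \<mu> k k' \<longleftrightarrow>
     (\<forall>f g :: 'a \<Rightarrow> complex. f \<in> Lp_space \<mu> 2 \<longrightarrow> g \<in> Lp_space \<mu> 2 \<longrightarrow>
        (LINT x|\<mu>. kernel_op \<mu> k f x * cnj (g x)) = (LINT x|\<mu>. f x * cnj (kernel_op \<mu> k' g x)))"

definition L2_compact :: "'a measure \<Rightarrow> ('a \<Rightarrow> 'a \<Rightarrow> real) \<Rightarrow> bool" where
  "L2_compact \<mu> k \<longleftrightarrow>
     (\<forall>F :: nat \<Rightarrow> 'a \<Rightarrow> complex.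
        (\<forall>n. F n \<in> Lp_space \<mu> 2) \<and> bounded (range (\<lambda>n. Lp_norm \<mu> 2 (F n))) \<longrightarrow>
        (\<exists>r g. strict_mono (r :: nat \<Rightarrow> nat) \<and> g \<in> Lp_space \<mu> 2 \<and>
           (\<lambda>n. Lp_norm \<mu> 2 (\<lambda>x. kernel_op \<mu> k (F (r n)) x - g x)) \<longlonglongrightarrow> 0))"

definition L2_Linf_bounded :: "'a measure \<Rightarrow> ('a \<Rightarrow> 'a \<Rightarrow> real) \<Rightarrow> bool" where
  "L2_Linf_bounded \<mu> k \<longleftrightarrow>
     (\<exists>C. \<forall>f::'a \<Rightarrow> complex. f \<in> Lp_space \<mu> 2 \<longrightarrow>
        kernel_op \<mu> k f \<in> Lp_space \<mu> \<infinity> \<and>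
        Lp_norm \<mu> \<infinity> (kernel_op \<mu> k f) \<le> C * Lp_norm \<mu> 2 f)"

definition positivity_preserving :: "'a measure \<Rightarrow> ('a \<Rightarrow> 'a \<Rightarrow> real) \<Rightarrow> bool" where
  "positivity_preserving \<mu> k \<longleftrightarrow>
     (\<forall>f::'a \<Rightarrow> real. f \<in> Lp_space \<mu> 2 \<longrightarrow> (AE x in \<mu>. f x \<ge> 0) \<longrightarrow>
        (AE x in \<mu>. kernel_op \<mu> k f x \<ge> 0))"

definition positivity_improving :: "'a measure \<Rightarrow> ('a \<Rightarrow> 'a \<Rightarrow> real) \<Rightarrow> bool" where
  "positivity_improving \<mu> k \<longleftrightarrow>
     (\<forall>f::'a \<Rightarrow> real. f \<in> Lp_space \<mu> 2 \<longrightarrow> (AE x in \<mu>. f x \<ge> 0) \<longrightarrow> \<not> (AE x in \<mu>. f x = 0) \<longrightarrow>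
        (AE x in \<mu>. kernel_op \<mu> k f x > 0))"

section \<open>Continuous versions\<close>

text \<open>
  Kernels are determined almost everywhere only, so \<open>U\<^sub>t f \<in> C\<^sub>b(M)\<close> means that the class of
  \<open>U\<^sub>t f\<close> has a bounded continuous representative. The representative is unique when the
  measure has full support.
\<close>

definition is_Cb_version ::
    "'a::topological_space measure \<Rightarrow> ('a \<Rightarrow> 'b::real_normed_vector) \<Rightarrow> ('a \<Rightarrow> 'b) \<Rightarrow> bool" where
  "is_Cb_version \<mu> f g \<longleftrightarrow> continuous_on UNIV g \<and> bounded (range g) \<and> (AE x in \<mu>. g x = f x)"

definition Cb_version ::
    "'a::topological_space measure \<Rightarrow> ('a \<Rightarrow> 'b::real_normed_vector) \<Rightarrow> 'a \<Rightarrow> 'b" where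
  "Cb_version \<mu> f = (THE g. is_Cb_version \<mu> f g)"

definition Cb_op ::
    "'a::topological_space measure \<Rightarrow> ('a \<Rightarrow> 'a \<Rightarrow> real) \<Rightarrow> ('a \<Rightarrow> 'b::{banach,second_countable_topology}) \<Rightarrow> 'a \<Rightarrow> 'b" where
  "Cb_op \<mu> k f = Cb_version \<mu> (kernel_op \<mu> k f)"

definition strong_Feller :: "'a::topological_space measure \<Rightarrow> (real \<Rightarrow> 'a \<Rightarrow> 'a \<Rightarrow> real) \<Rightarrow> bool" where
  "strong_Feller \<mu> u \<longleftrightarrow>
     (\<forall>t>0. \<forall>f::'a \<Rightarrow> complex. f \<in> Lp_space \<mu> \<infinity> \<longrightarrow>
        kernel_integrable \<mu> (u t) f \<and> (\<exists>g. is_Cb_version \<mu> (kernel_op \<mu> (u t) f) g))"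

section \<open>Semigroups and their generators\<close>

definition sg_op ::
    "'a measure \<Rightarrow> (real \<Rightarrow> 'a \<Rightarrow> 'a \<Rightarrow> real) \<Rightarrow> real \<Rightarrow> ('a \<Rightarrow> complex) \<Rightarrow> 'a \<Rightarrow> complex" where
  "sg_op \<mu> u t f = (if t = 0 then f else kernel_op \<mu> (u t) f)"

definition strongly_continuous_semigroup ::
    "'a measure \<Rightarrow> (real \<Rightarrow> 'a \<Rightarrow> 'a \<Rightarrow> real) \<Rightarrow> bool" where
  "strongly_continuous_semigroup \<mu> u \<longleftrightarrow>
     (\<forall>t>0. L2_bounded \<mu> (u t)) \<and>
     (\<forall>s\<ge>0. \<forall>t\<ge>0. \<forall>f \<in> Lp_space \<mu> 2.
        AE x in \<mu>. sg_op \<mu> u (s + t) f x = sg_op \<mu> u s (sg_op \<mu> u t f) x) \<and>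
     (\<forall>f \<in> Lp_space \<mu> 2. \<forall>t\<ge>0.
        ((\<lambda>s. Lp_norm \<mu> 2 (\<lambda>x. sg_op \<mu> u s f x - sg_op \<mu> u t f x)) \<longlongrightarrow> 0) (at t within {0..}))"

text \<open>
  Unbounded operators on \<open>L\<^sup>2\<close> are given by their graphs: \<open>neg_generator \<mu> u f g\<close> says that \<open>f\<close>
  is in the domain of the generator \<open>A\<close> and \<open>g = - A f\<close>.
\<close>

definition neg_generator ::
    "'a measure \<Rightarrow> (real \<Rightarrow> 'a \<Rightarrow> 'a \<Rightarrow> real) \<Rightarrow> ('a \<Rightarrow> complex) \<Rightarrow> ('a \<Rightarrow> complex) \<Rightarrow> bool" where
  "neg_generator \<mu> u f g \<longleftrightarrow> f \<in> Lp_space \<mu> 2 \<and> g \<in> Lp_space \<mu> 2 \<and>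
     ((\<lambda>t. Lp_norm \<mu> 2 (\<lambda>x. (sg_op \<mu> u t f x - f x) / complex_of_real t - (- g x)))
        \<longlongrightarrow> 0) (at_right 0)"

text \<open>
  \<open>z\<close> is in the resolvent set of \<open>G\<close> if \<open>z - G\<close> maps the domain of \<open>G\<close> bijectively onto \<open>L\<^sup>2\<close>
  with bounded inverse; the norm estimate contains injectivity.
\<close>

definition L2_resolvent_set ::
    "'a measure \<Rightarrow> (('a \<Rightarrow> complex) \<Rightarrow> ('a \<Rightarrow> complex) \<Rightarrow> bool) \<Rightarrow> complex set" where
  "L2_resolvent_set \<mu> G = {z.
     (\<forall>h \<in> Lp_space \<mu> 2. \<exists>f g. G f g \<and> (AE x in \<mu>. z * f x - g x = h x)) \<and>
     (\<exists>C. \<forall>f g. G f g \<longrightarrow> Lp_norm \<mu> 2 f \<le> C * Lp_norm \<mu> 2 (\<lambda>x. z * f x - g x))}"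

definition L2_spectrum ::
    "'a measure \<Rightarrow> (('a \<Rightarrow> complex) \<Rightarrow> ('a \<Rightarrow> complex) \<Rightarrow> bool) \<Rightarrow> complex set" where
  "L2_spectrum \<mu> G = - L2_resolvent_set \<mu> G"

definition ground_energy :: "'a measure \<Rightarrow> (real \<Rightarrow> 'a \<Rightarrow> 'a \<Rightarrow> real) \<Rightarrow> real" where
  "ground_energy \<mu> u = Inf (Re ` L2_spectrum \<mu> (neg_generator \<mu> u))"

definition ground_state ::
    "'a::topological_space measure \<Rightarrow> (real \<Rightarrow> 'a \<Rightarrow> 'a \<Rightarrow> real) \<Rightarrow> real \<Rightarrow> ('a \<Rightarrow> real) \<Rightarrow> bool" where
  "ground_state \<mu> u l \<phi> \<longleftrightarrow>
     neg_generator \<mu> u (\<lambda>x. complex_of_real (\<phi> x)) (\<lambda>x. complex_of_real (l * \<phi> x)) \<and>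
     Lp_norm \<mu> 2 \<phi> = 1 \<and> (AE x in \<mu>. \<phi> x > 0) \<and>
     continuous_on UNIV \<phi> \<and> bounded (range \<phi>)"

section \<open>Heat content and quasi-stationary measures\<close>

definition heat_content :: "'a::topological_space measure \<Rightarrow> (real \<Rightarrow> 'a \<Rightarrow> 'a \<Rightarrow> real) \<Rightarrow> real \<Rightarrow> ennreal" where
  "heat_content \<mu> u t = (\<integral>\<^sup>+ x. ennreal (Cb_op \<mu> (u t) (\<lambda>_. 1::real) x) \<partial>\<mu>)"

text \<open>
  In \<open>quasi_stationary\<close>, \<open>f\<close> ranges over all representatives of elements of \<open>L\<^sup>\<infinity>(M, \<mu>)\<close>; applied to
  indicators of null sets the condition makes \<open>\<nu>\<close> absolutely continuous, so \<open>\<nu>(f)\<close> depends on the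
  class of \<open>f\<close> only.
\<close>

definition normalized_measure :: "'a measure \<Rightarrow> ('a \<Rightarrow> real) \<Rightarrow> 'a measure" where
  "normalized_measure \<mu> \<psi> = density \<mu> (\<lambda>x. ennreal (\<psi> x / (LINT y|\<mu>. \<psi> y)))"

definition quasi_stationary ::
    "'a::topological_space measure \<Rightarrow> (real \<Rightarrow> 'a \<Rightarrow> 'a \<Rightarrow> real) \<Rightarrow> 'a measure \<Rightarrow> bool" where
  "quasi_stationary \<mu> u \<nu> \<longleftrightarrow> prob_space \<nu> \<and> sets \<nu> = sets borel \<and>
     (\<forall>t>0. \<forall>f::'a \<Rightarrow> complex. f \<in> Lp_space \<mu> \<infinity> \<longrightarrow>
        (LINT x|\<nu>. Cb_op \<mu> (u t) (\<lambda>_. 1::real) x) > 0 \<and>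
        (LINT x|\<nu>. Cb_op \<mu> (u t) f x) / (LINT x|\<nu>. Cb_op \<mu> (u t) (\<lambda>_. 1) x) = (LINT x|\<nu>. f x))"

end

theory Submission
  imports Defs
begin

text \<open>
  The known convergence bound compares \<open>exp(l0 t) u\<^sub>t(x, y)\<close> with the rank-one kernel
  \<open>\<phi>0(x) \<psi>0(y) / \<Lambda>\<close>, up to an error \<open>C\<^sub>0 exp(- \<gamma> t)\<close> that is uniform in \<open>x\<close> and \<open>y\<close>. When \<open>\<mu>\<close> is
  infinite such an error cannot be integrated against \<open>f\<close>. The remedy is to write
  \<open>U\<^sub>t = U\<^sub>t\<^sub>1 U\<^sub>r U\<^sub>t\<^sub>1\<close> with \<open>r = t - 2 t\<^sub>1\<close> and to use the bound for \<open>U\<^sub>r\<close> alone. The rank-one part is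
  reproduced, since \<open>\<phi>0\<close> and \<open>\<psi>0\<close> are eigenfunctions (\<open>eigenfunction\<close>), and the error becomes a
  multiple of \<open>exp(- \<gamma> t) (U\<^sub>t\<^sub>1 1)(x) (U\<^sub>t\<^sub>1\<^sup>* 1)(y)\<close> (\<open>kernel_estimate\<close>). Finiteness of the heat content
  says precisely that \<open>U\<^sub>t\<^sub>1\<^sup>* 1\<close> is integrable. As it is bounded too, it pairs with the unit ball of
  every \<open>L\<^sup>p\<close> (\<open>weighted_integral_bound_Lp\<close>), which yields
  \<open>\<bar>exp(l0 t) U\<^sub>t f(x) - \<phi>0(x) \<integral> \<psi>0 f / \<Lambda>\<bar> \<le> C exp(- \<gamma> t) (U\<^sub>t\<^sub>1 1)(x)\<close> (\<open>operator_estimate\<close>).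

  In \<open>U\<^sub>t f - m(f) U\<^sub>t 1\<close> the rank-one parts cancel, and \<open>exp(l0 t) U\<^sub>t 1 \<ge> \<phi>0 / sup \<phi>0\<close>
  (\<open>survival_lower_bound\<close>); dividing gives the pointwise estimate (\<open>ratio_estimate\<close>). It is uniform on a
  compact set on which \<open>\<phi>0 > 0\<close>, because \<open>\<phi>0\<close> is bounded away from zero there and \<open>U\<^sub>t\<^sub>1 1\<close> is
  bounded. The measure \<open>m\<close> is quasi-stationary because \<open>\<psi>0\<close> is an eigenfunction of the adjoint
  semigroup, and a second quasi-stationary measure that charges \<open>{\<phi>0 > 0}\<close> is identified with \<open>m\<close> by
  integrating the operator estimate against it (\<open>quasi_stationary_unique\<close>).

  The argument lives on kernels, whereas positivity and the semigroup law are given for operators on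
  \<open>L\<^sup>2\<close>. Both are transferred to the kernels, outside a null set, by comparing the measures that they define
  (\<open>kernel_AE_nonneg\<close>, \<open>kernel_composition_AE\<close>). The resulting hypotheses are invariant under
  passage to the adjoint, so everything is proved once, for a locale, and used twice.
\<close>

section \<open>Almost everywhere statements under full support\<close>

text \<open>
  Under full support an exceptional null set that is open is empty. This is how estimates that
  integrals give almost everywhere become pointwise statements about continuous versions.
\<close>

lemma AE_closed_imp_everywhere:
  assumes borel: "sets \<mu> = sets borel" and supp: "full_support \<mu>"
    and cl: "closed {x. P x}" and ae: "AE x in \<mu>. P x"
  shows "P x"
proof (rule ccontr)
  assume "\<not> P x"
  let ?V = "- {x. P x}"
  have "open ?V" "?V \<noteq> {}" using cl \<open>\<not> P x\<close> by auto
  then have "emeasure \<mu> ?V > 0" using supp by (auto simp: full_support_def)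
  moreover have "emeasure \<mu> {x \<in> space \<mu>. \<not> P x} = 0"
    by (rule emeasure_eq_0_AE) (use ae in simp)
  moreover have "space \<mu> = UNIV" using borel by (metis sets_eq_imp_space_eq space_borel)
  ultimately show False by (simp add: Compl_eq)
qed

lemma Cb_version_eqI:
  fixes g :: "'a::topological_space \<Rightarrow> 'b::real_normed_vector"
  assumes borel: "sets \<mu> = sets borel" and supp: "full_support \<mu>" and g: "is_Cb_version \<mu> f g"
  shows "Cb_version \<mu> f = g"
  unfolding Cb_version_def
proof (rule the_equality, rule g)
  fix h assume h: "is_Cb_version \<mu> f h"
  have "AE x in \<mu>. h x = g x"
    using g h unfolding is_Cb_version_def by (auto elim: eventually_elim2)
  moreover have "closed {x. h x = g x}"
    using g h unfolding is_Cb_version_def by (intro closed_Collect_eq) auto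
  ultimately show "h = g"
    using AE_closed_imp_everywhere[OF borel supp] by blast
qed

lemma locally_finite_imp_sigma_finite:
  fixes \<mu> :: "'a::second_countable_topology measure"
  assumes borel: "sets \<mu> = sets borel" and "locally_finite_measure \<mu>"
  shows "sigma_finite_measure \<mu>"
proof
  let ?F = "{V. open V \<and> emeasure \<mu> V < \<infinity>}"
  have "open S" if "S \<in> ?F" for S using that by simp
  then obtain F where F: "F \<subseteq> ?F" "countable F" "\<Union>F = \<Union>?F"
    by (rule Lindelof)
  have "\<Union>?F = UNIV" using assms(2) unfolding locally_finite_measure_def by auto
  moreover have "space \<mu> = UNIV" using borel by (metis sets_eq_imp_space_eq space_borel)
  ultimately have "\<Union>F = space \<mu>" using F(3) by simp
  moreover have "V \<in> sets \<mu> \<and> emeasure \<mu> V \<noteq> \<infinity>" if "V \<in> F" for V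
    using F(1) that borel by (auto simp: subset_eq)
  ultimately show "\<exists>A. countable A \<and> A \<subseteq> sets \<mu> \<and> \<Union>A = space \<mu> \<and> (\<forall>a\<in>A. emeasure \<mu> a \<noteq> \<infinity>)"
    using F(2) by (intro exI[of _ F]) (simp add: subset_eq)
qed

section \<open>Positivity and composition on the level of kernels\<close>

lemma indicator_in_L2:
  fixes \<mu> :: "'a measure"
  assumes "A \<in> sets \<mu>" "emeasure \<mu> A < \<infinity>"
  shows "(\<lambda>x. indicator A x *\<^sub>R c :: 'b::{banach,second_countable_topology}) \<in> Lp_space \<mu> 2"
proof -
  have "(\<lambda>x. norm (indicat_real A x *\<^sub>R c) powr 2) = (\<lambda>x. indicator A x *\<^sub>R (norm c powr 2))"
    by (auto simp: indicator_def)
  moreover have "integrable \<mu> (\<lambda>x. indicator A x *\<^sub>R (norm c powr 2))"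
    using assms by (intro integrable_indicator) auto
  ultimately show ?thesis
    using assms unfolding Lp_space_def by simp
qed

text \<open>
  Testing positivity on indicators of finite measure gives \<open>\<integral>\<^sub>A k(x, y) \<mu>(dy) \<ge> 0\<close> for almost every \<open>x\<close>,
  but with a null set that depends on \<open>A\<close>. A countable family of sets \<open>A\<close> is harmless, and finite
  unions of basis sets suffice: they exhaust every open set, and for fixed \<open>x\<close> the finite Borel measure
  with density \<open>max 0 (k x y)\<close> is outer regular, so its domination of the measure with density
  \<open>max 0 (- k x y)\<close> extends from open sets to the Borel set \<open>{y. k x y < 0}\<close>, where the first vanishes.
\<close>

lemma kernel_AE_nonneg:
  fixes k :: "'a::polish_space \<Rightarrow> 'a \<Rightarrow> real"
  assumes borel: "sets \<mu> = sets borel" and sf: "sigma_finite_measure \<mu>"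
    and pp: "positivity_preserving \<mu> k" and int: "AE x in \<mu>. integrable \<mu> (k x)"
  shows "AE x in \<mu>. AE y in \<mu>. 0 \<le> k x y"
proof -
  interpret sigma_finite_measure \<mu> by fact
  have sp: "space \<mu> = UNIV" using borel by (metis sets_eq_imp_space_eq space_borel)
  obtain F :: "nat \<Rightarrow> 'a set" where F: "range F \<subseteq> sets \<mu>" "(\<Union>i. F i) = UNIV"
    "\<And>i. emeasure \<mu> (F i) \<noteq> \<infinity>" "incseq F"
    using sigma_finite_incseq sp by metis
  obtain B :: "'a set set" where B: "countable B" "topological_basis B"
    using ex_countable_basis by blast
  define \<U> where "\<U> = Union ` {S. S \<subseteq> B \<and> finite S}"
  have count: "countable \<U>"
    unfolding \<U>_def using countable_Collect_finite_subset[OF B(1)] by (intro countable_image) (simp add: conj_commute)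
  have openU: "open U" if "U \<in> \<U>" for U
    using that B(2) unfolding \<U>_def by (auto intro: topological_basis_open)
  have "AE x in \<mu>. 0 \<le> (LINT y|\<mu>. k x y * indicator (U \<inter> F n) y)" if "U \<in> \<U>" for U n
  proof -
    have m: "U \<inter> F n \<in> sets \<mu>" using openU[OF that] F(1) borel by auto
    have "emeasure \<mu> (U \<inter> F n) \<le> emeasure \<mu> (F n)" using F(1) by (intro emeasure_mono) auto
    then have fin: "emeasure \<mu> (U \<inter> F n) < \<infinity>" using F(3)[of n] by (simp add: less_top)
    show ?thesis
      using pp[unfolded positivity_preserving_def, rule_format, of "indicator (U \<inter> F n)"]
        indicator_in_L2[OF m fin, of "1::real"] unfolding kernel_op_def by simp
  qed
  then have "AE x in \<mu>. \<forall>U\<in>\<U>. \<forall>n. 0 \<le> (LINT y|\<mu>. k x y * indicator (U \<inter> F n) y)"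
    using count by (simp add: AE_ball_countable AE_all_countable)
  with int show ?thesis
  proof eventually_elim
    fix x assume ki: "integrable \<mu> (k x)"
      and pos: "\<forall>U\<in>\<U>. \<forall>n. 0 \<le> (LINT y|\<mu>. k x y * indicator (U \<inter> F n) y)"
    note [measurable] = borel_measurable_integrable[OF ki]
    define P where "P = density \<mu> (\<lambda>y. ennreal (k x y))"
    define Q where "Q = density \<mu> (\<lambda>y. ennreal (- k x y))"
    have sets: "sets P = sets borel" "sets Q = sets borel" unfolding P_def Q_def by (simp_all add: borel)
    have P: "emeasure P A = ennreal (LINT y|\<mu>. max 0 (k x y) * indicator A y)" if "A \<in> sets borel" for A
    proof -
      have [measurable]: "A \<in> sets \<mu>" using that borel by simp
      have "emeasure P A = (\<integral>\<^sup>+y. ennreal (max 0 (k x y) * indicator A y) \<partial>\<mu>)"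
        unfolding P_def by (subst emeasure_density) (auto intro!: nn_integral_cong simp: indicator_def max_def ennreal_neg)
      also have "\<dots> = ennreal (LINT y|\<mu>. max 0 (k x y) * indicator A y)"
        using ki by (intro nn_integral_eq_integral integrable_real_mult_indicator integrable_max) auto
      finally show ?thesis .
    qed
    have Q: "emeasure Q A = ennreal (LINT y|\<mu>. max 0 (- k x y) * indicator A y)" if "A \<in> sets borel" for A
    proof -
      have [measurable]: "A \<in> sets \<mu>" using that borel by simp
      have "emeasure Q A = (\<integral>\<^sup>+y. ennreal (max 0 (- k x y) * indicator A y) \<partial>\<mu>)"
        unfolding Q_def by (subst emeasure_density) (auto intro!: nn_integral_cong simp: indicator_def max_def ennreal_neg)
      also have "\<dots> = ennreal (LINT y|\<mu>. max 0 (- k x y) * indicator A y)"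
        using ki by (intro nn_integral_eq_integral integrable_real_mult_indicator integrable_max) auto
      finally show ?thesis .
    qed
    have basic: "emeasure Q (U \<inter> F n) \<le> emeasure P (U \<inter> F n)" if "U \<in> \<U>" for U n
    proof -
      have A[measurable]: "U \<inter> F n \<in> sets \<mu>" "U \<inter> F n \<in> sets borel" using openU[OF that] F(1) borel by auto
      let ?p = "\<lambda>y. max 0 (k x y) * indicator (U \<inter> F n) y"
      let ?q = "\<lambda>y. max 0 (- k x y) * indicator (U \<inter> F n) y"
      have i: "integrable \<mu> ?p" "integrable \<mu> ?q"
        using ki by (intro integrable_real_mult_indicator integrable_max; simp)+
      have "(LINT y|\<mu>. ?p y) - (LINT y|\<mu>. ?q y) = (LINT y|\<mu>. ?p y - ?q y)"
        using i by simp
      also have "\<dots> = (LINT y|\<mu>. k x y * indicator (U \<inter> F n) y)"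
        by (intro Bochner_Integration.integral_cong) (auto simp: indicator_def)
      also have "\<dots> \<ge> 0" using pos that by blast
      finally show ?thesis by (simp add: P[OF A(2)] Q[OF A(2)] ennreal_leI)
    qed
    have opn: "emeasure Q V \<le> emeasure P V" if "open V" for V
    proof -
      have "\<exists>S\<subseteq>B. \<Union>S = V" using B(2) that unfolding topological_basis_def by simp
      then obtain S where S: "S \<subseteq> B" "\<Union>S = V" by auto
      have cS: "countable (insert {} S)" using B(1) S(1) countable_subset by auto
      \<comment> \<open>The empty set is inserted so that the enumeration also covers an empty \<open>S\<close>.\<close>
      define G where "G n = \<Union> (from_nat_into (insert {} S) ` {..n}) " for n
      have G: "G n \<in> \<U>" for n
      proof -
        have "G n = \<Union> (from_nat_into (insert {} S) ` {..n} - {{}})" unfolding G_def by auto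
        moreover have "from_nat_into (insert {} S) ` {..n} - {{}} \<subseteq> S"
          using from_nat_into[of "insert {} S"] by auto
        ultimately show ?thesis unfolding \<U>_def using S(1) by blast
      qed
      have UG: "(\<Union>n. G n) = V"
      proof -
        have "(\<Union>n. G n) = \<Union> (range (from_nat_into (insert {} S)))" unfolding G_def by auto
        also have "\<dots> = V" using range_from_nat_into[OF _ cS] S(2) by simp
        finally show ?thesis .
      qed
      have incG: "incseq G" unfolding G_def incseq_def by (intro allI impI Union_mono image_mono) auto
      have inc: "incseq (\<lambda>n. G n \<inter> F n)" using incG F(4) unfolding incseq_def by blast
      have U: "(\<Union>n. G n \<inter> F n) = V"
      proof
        show "V \<subseteq> (\<Union>n. G n \<inter> F n)"
        proof
          fix z assume "z \<in> V"
          then obtain i j where "z \<in> G i" "z \<in> F j" using UG F(2) by blast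
          then have "z \<in> G (max i j) \<inter> F (max i j)"
            using incG F(4) unfolding incseq_def by (meson IntI max.cobounded1 max.cobounded2 subsetD)
          then show "z \<in> (\<Union>n. G n \<inter> F n)" by blast
        qed
      qed (use UG in auto)
      have sb: "G n \<inter> F n \<in> sets borel" for n using openU[OF G[of n]] F(1) borel by auto
      have "emeasure Q V = (SUP n. emeasure Q (G n \<inter> F n))"
        using SUP_emeasure_incseq[OF _ inc, of Q] sb sets U by (simp add: image_subset_iff)
      also have "\<dots> \<le> (SUP n. emeasure P (G n \<inter> F n))" using basic G by (intro SUP_mono) blast
      also have "\<dots> = emeasure P V"
        using SUP_emeasure_incseq[OF _ inc, of P] sb sets U by (simp add: image_subset_iff)
      finally show ?thesis .
    qed
    define N where "N = {y. k x y < 0}"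
    have N[measurable]: "N \<in> sets borel" "N \<in> sets \<mu>"
    proof -
      have "{y \<in> space \<mu>. k x y < 0} \<in> sets \<mu>" by measurable
      then show "N \<in> sets borel" "N \<in> sets \<mu>" unfolding N_def by (simp_all add: sp borel)
    qed
    have fin: "emeasure P (space P) \<noteq> \<infinity>" using P[of UNIV] sets sp by (simp add: P_def)
    have "emeasure P N = (INF U\<in>{U. N \<subseteq> U \<and> open U}. emeasure P U)"
      using outer_regular[OF sets(1) fin N(1)] .
    also have "\<dots> \<ge> emeasure Q N"
    proof (rule INF_greatest)
      fix U assume U: "U \<in> {U. N \<subseteq> U \<and> open U}"
      then have "emeasure Q N \<le> emeasure Q U" using sets by (intro emeasure_mono) auto
      also have "\<dots> \<le> emeasure P U" using opn U by auto
      finally show "emeasure Q N \<le> emeasure P U" .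
    qed
    finally have "emeasure Q N \<le> emeasure P N" .
    moreover have "emeasure P N = 0"
      unfolding P[OF N(1)] by (simp add: N_def indicator_def max_def Bochner_Integration.integral_eq_zero_AE)
    ultimately have "emeasure Q N = 0" by simp
    then have "AE y in \<mu>. y \<in> N \<longrightarrow> ennreal (- k x y) = 0"
      unfolding Q_def by (simp add: emeasure_density nn_integral_0_iff_AE) (auto elim!: eventually_mono simp: indicator_def split: if_splits)
    then show "AE y in \<mu>. 0 \<le> k x y"
      by eventually_elim (auto simp: N_def ennreal_eq_0_iff)
  qed
qed

text \<open>
  The Chapman-Kolmogorov identity between kernels, from the corresponding identity between operators
  on \<open>L\<^sup>2\<close>. Applied to indicators the operator identity says that \<open>k3(x, y)\<close> and
  \<open>\<integral> k1(x, z) k2(z, y) \<mu>(dz)\<close> are densities of measures that agree on rectangles, hence everywhere.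
  The bound on \<open>\<integral> k3(x, y) \<mu>(dy)\<close> makes the first of these measures \<open>\<sigma>\<close>-finite along rectangles, as
  uniqueness of extensions requires.
\<close>

lemma kernel_composition_AE:
  fixes k1 k2 k3 :: "'a \<Rightarrow> 'a \<Rightarrow> real"
  assumes sf: "sigma_finite_measure \<mu>"
    and m1: "(\<lambda>(x, y). k1 x y) \<in> borel_measurable (\<mu> \<Otimes>\<^sub>M \<mu>)"
    and m2: "(\<lambda>(x, y). k2 x y) \<in> borel_measurable (\<mu> \<Otimes>\<^sub>M \<mu>)"
    and m3: "(\<lambda>(x, y). k3 x y) \<in> borel_measurable (\<mu> \<Otimes>\<^sub>M \<mu>)"
    and n1: "AE x in \<mu>. AE y in \<mu>. 0 \<le> k1 x y"
    and n2: "AE x in \<mu>. AE y in \<mu>. 0 \<le> k2 x y"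
    and n3: "AE x in \<mu>. AE y in \<mu>. 0 \<le> k3 x y"
    and b1: "L2_bounded \<mu> k1" and b2: "L2_bounded \<mu> k2" and b3: "L2_bounded \<mu> k3"
    and comp: "\<And>f::'a \<Rightarrow> complex. f \<in> Lp_space \<mu> 2 \<Longrightarrow>
      AE x in \<mu>. kernel_op \<mu> k3 f x = kernel_op \<mu> k1 (kernel_op \<mu> k2 f) x"
    and bound: "AE x in \<mu>. (\<integral>\<^sup>+y. ennreal (k3 x y) \<partial>\<mu>) \<le> ennreal C"
  shows "AE x in \<mu>. AE y in \<mu>. integrable \<mu> (\<lambda>z. k1 x z * k2 z y) \<and> k3 x y = (LINT z|\<mu>. k1 x z * k2 z y)"
proof -
  interpret sigma_finite_measure \<mu> by fact
  interpret pair: pair_sigma_finite \<mu> \<mu> by standard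
  note [measurable] = measurable_Pair_compose_split[OF m1] measurable_Pair_compose_split[OF m2]
    measurable_Pair_compose_split[OF m3]
  obtain F :: "nat \<Rightarrow> 'a set" where F: "range F \<subseteq> sets \<mu>" "(\<Union>i. F i) = space \<mu>"
    "\<And>i. emeasure \<mu> (F i) \<noteq> \<infinity>" "incseq F"
    using sigma_finite_incseq by metis
  define w where "w x y = (\<integral>\<^sup>+z. ennreal (k1 x z) * ennreal (k2 z y) \<partial>\<mu>)" for x y
  have w[measurable]: "case_prod w \<in> borel_measurable (\<mu> \<Otimes>\<^sub>M \<mu>)" unfolding w_def by measurable
  have k3[measurable]: "(\<lambda>(x, y). ennreal (k3 x y)) \<in> borel_measurable (\<mu> \<Otimes>\<^sub>M \<mu>)" by measurable
  have slice: "AE x in \<mu>. (\<integral>\<^sup>+y. ennreal (k3 x y) * indicator B y \<partial>\<mu>) = (\<integral>\<^sup>+y. w x y * indicator B y \<partial>\<mu>)"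
    if B[measurable]: "B \<in> sets \<mu>" and finB: "emeasure \<mu> B < \<infinity>" for B
  proof -
    have opr: "kernel_op \<mu> k (\<lambda>y. complex_of_real (g y)) x = complex_of_real (LINT y|\<mu>. k x y * g y)"
      for k :: "'a \<Rightarrow> 'a \<Rightarrow> real" and g x
      unfolding kernel_op_def by (simp add: scaleR_conv_of_real flip: of_real_mult)
    have inr: "AE x in \<mu>. integrable \<mu> (\<lambda>y. k x y * g y)"
      if "L2_bounded \<mu> k" "(\<lambda>y. complex_of_real (g y)) \<in> Lp_space \<mu> 2" for k :: "'a \<Rightarrow> 'a \<Rightarrow> real" and g
    proof -
      have "kernel_integrable \<mu> k (\<lambda>y. complex_of_real (g y))"
        using that unfolding L2_bounded_def by blast
      then show ?thesis unfolding kernel_integrable_def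
        by eventually_elim (simp add: scaleR_conv_of_real complex_of_real_integrable_eq flip: of_real_mult)
    qed
    define f where "f y = complex_of_real (indicator B y)" for y
    define g where "g x = (LINT y|\<mu>. k2 x y * indicator B y)" for x
    have f: "f \<in> Lp_space \<mu> 2"
      using indicator_in_L2[OF B finB, of "1::complex"] unfolding f_def by (simp add: scaleR_conv_of_real)
    have op2: "kernel_op \<mu> k2 f = (\<lambda>x. complex_of_real (g x))"
      unfolding f_def g_def by (rule ext) (rule opr)
    have g: "(\<lambda>x. complex_of_real (g x)) \<in> Lp_space \<mu> 2"
      using b2 f unfolding L2_bounded_def op2[symmetric] by blast
    have i2: "AE x in \<mu>. integrable \<mu> (\<lambda>y. k2 x y * indicator B y)"
      and i3: "AE x in \<mu>. integrable \<mu> (\<lambda>y. k3 x y * indicator B y)"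
      and i1: "AE x in \<mu>. integrable \<mu> (\<lambda>z. k1 x z * g z)"
      using inr[OF b2 f[unfolded f_def]] inr[OF b3 f[unfolded f_def]] inr[OF b1 g] by auto
    have gn: "AE z in \<mu>. 0 \<le> g z \<and> ennreal (g z) = (\<integral>\<^sup>+y. ennreal (k2 z y) * indicator B y \<partial>\<mu>)"
      using i2 n2
    proof eventually_elim
      fix z assume i: "integrable \<mu> (\<lambda>y. k2 z y * indicat_real B y)" and n: "AE y in \<mu>. 0 \<le> k2 z y"
      have n': "AE y in \<mu>. 0 \<le> k2 z y * indicat_real B y" using n by eventually_elim simp
      have "(\<integral>\<^sup>+y. ennreal (k2 z y) * indicator B y \<partial>\<mu>) = (\<integral>\<^sup>+y. ennreal (k2 z y * indicat_real B y) \<partial>\<mu>)"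
        by (intro nn_integral_cong) (simp add: indicator_def)
      also have "\<dots> = ennreal (g z)" unfolding g_def by (rule nn_integral_eq_integral[OF i n'])
      finally show "0 \<le> g z \<and> ennreal (g z) = (\<integral>\<^sup>+y. ennreal (k2 z y) * indicator B y \<partial>\<mu>)"
        using integral_nonneg_AE[OF n'] unfolding g_def by simp
    qed
    show ?thesis using comp[OF f] i1 i3 n1 n3 AE_space
    proof eventually_elim
      fix x
      assume x: "x \<in> space \<mu>" and eq: "kernel_op \<mu> k3 f x = kernel_op \<mu> k1 (kernel_op \<mu> k2 f) x"
        and i1: "integrable \<mu> (\<lambda>z. k1 x z * g z)" and i3: "integrable \<mu> (\<lambda>y. k3 x y * indicat_real B y)"
        and n1: "AE y in \<mu>. 0 \<le> k1 x y" and n3: "AE y in \<mu>. 0 \<le> k3 x y"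
      have eq': "(LINT y|\<mu>. k3 x y * indicator B y) = (LINT z|\<mu>. k1 x z * g z)"
        using eq unfolding op2 unfolding f_def opr by (simp only: of_real_eq_iff)
      have n3': "AE y in \<mu>. 0 \<le> k3 x y * indicat_real B y" using n3 by eventually_elim simp
      have n1': "AE z in \<mu>. 0 \<le> k1 x z * g z" using n1 gn by eventually_elim simp
      have "(\<integral>\<^sup>+y. ennreal (k3 x y) * indicator B y \<partial>\<mu>) = (\<integral>\<^sup>+y. ennreal (k3 x y * indicat_real B y) \<partial>\<mu>)"
        by (intro nn_integral_cong) (simp add: indicator_def)
      also have "\<dots> = (\<integral>\<^sup>+z. ennreal (k1 x z * g z) \<partial>\<mu>)"
        using nn_integral_eq_integral[OF i3 n3'] nn_integral_eq_integral[OF i1 n1'] eq' by simp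
      also have "\<dots> = (\<integral>\<^sup>+z. (\<integral>\<^sup>+y. ennreal (k1 x z) * ennreal (k2 z y) * indicator B y \<partial>\<mu>) \<partial>\<mu>)"
      proof (rule nn_integral_cong_AE)
        show "AE z in \<mu>. ennreal (k1 x z * g z) = (\<integral>\<^sup>+y. ennreal (k1 x z) * ennreal (k2 z y) * indicator B y \<partial>\<mu>)"
          using n1 gn AE_space
        proof eventually_elim
          fix z assume "0 \<le> k1 x z" and gz: "0 \<le> g z \<and> ennreal (g z) = (\<integral>\<^sup>+y. ennreal (k2 z y) * indicator B y \<partial>\<mu>)"
            and "z \<in> space \<mu>"
          then have "ennreal (k1 x z * g z) = ennreal (k1 x z) * (\<integral>\<^sup>+y. ennreal (k2 z y) * indicator B y \<partial>\<mu>)"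
            by (simp add: ennreal_mult)
          also have "\<dots> = (\<integral>\<^sup>+y. ennreal (k1 x z) * (ennreal (k2 z y) * indicator B y) \<partial>\<mu>)"
            using \<open>z \<in> space \<mu>\<close> by (intro nn_integral_cmult[symmetric]) measurable
          finally show "ennreal (k1 x z * g z) = (\<integral>\<^sup>+y. ennreal (k1 x z) * ennreal (k2 z y) * indicator B y \<partial>\<mu>)"
            by (simp add: mult.assoc)
        qed
      qed
      also have "\<dots> = (\<integral>\<^sup>+y. w x y * indicator B y \<partial>\<mu>)"
      proof -
        have "(\<integral>\<^sup>+z. (\<integral>\<^sup>+y. ennreal (k1 x z) * ennreal (k2 z y) * indicator B y \<partial>\<mu>) \<partial>\<mu>)
          = (\<integral>\<^sup>+y. (\<integral>\<^sup>+z. ennreal (k1 x z) * ennreal (k2 z y) * indicator B y \<partial>\<mu>) \<partial>\<mu>)"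
          using x by (intro pair.Fubini'[symmetric]) measurable
        also have "\<dots> = (\<integral>\<^sup>+y. w x y * indicator B y \<partial>\<mu>)"
          unfolding w_def using x by (intro nn_integral_cong nn_integral_multc) measurable
        finally show ?thesis .
      qed
      finally show "(\<integral>\<^sup>+y. ennreal (k3 x y) * indicator B y \<partial>\<mu>) = (\<integral>\<^sup>+y. w x y * indicator B y \<partial>\<mu>)" .
    qed
  qed
  define D where "D d = density (\<mu> \<Otimes>\<^sub>M \<mu>) (\<lambda>(x, y). d x y)" for d :: "'a \<Rightarrow> 'a \<Rightarrow> ennreal"
  let ?k = "\<lambda>x y. ennreal (k3 x y)"
  have emD: "emeasure (D d) (A \<times> B) = (\<integral>\<^sup>+x. (\<integral>\<^sup>+y. d x y * indicator B y \<partial>\<mu>) * indicator A x \<partial>\<mu>)"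
    if d[measurable]: "case_prod d \<in> borel_measurable (\<mu> \<Otimes>\<^sub>M \<mu>)" and [measurable]: "A \<in> sets \<mu>" "B \<in> sets \<mu>" for d A B
  proof -
    have "emeasure (D d) (A \<times> B) = (\<integral>\<^sup>+p. (case p of (x, y) \<Rightarrow> d x y * indicator B y * indicator A x) \<partial>(\<mu> \<Otimes>\<^sub>M \<mu>))"
      unfolding D_def by (subst emeasure_density) (auto intro!: nn_integral_cong simp: indicator_def)
    also have "\<dots> = (\<integral>\<^sup>+x. (\<integral>\<^sup>+y. d x y * indicator B y * indicator A x \<partial>\<mu>) \<partial>\<mu>)"
      by (subst nn_integral_fst[symmetric]) auto
    also have "\<dots> = (\<integral>\<^sup>+x. (\<integral>\<^sup>+y. d x y * indicator B y \<partial>\<mu>) * indicator A x \<partial>\<mu>)"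
      by (intro nn_integral_cong nn_integral_multc) measurable
    finally show ?thesis .
  qed
  have rect_fin: "emeasure (D ?k) (A \<times> B) = emeasure (D w) (A \<times> B)"
    if "A \<in> sets \<mu>" "B \<in> sets \<mu>" "emeasure \<mu> B < \<infinity>" for A B
    unfolding emD[OF k3 that(1,2)] emD[OF w that(1,2)]
    by (intro nn_integral_cong_AE) (use slice[OF that(2,3)] in \<open>eventually_elim; simp\<close>)
  have rect: "emeasure (D ?k) (A \<times> B) = emeasure (D w) (A \<times> B)" if A: "A \<in> sets \<mu>" and B: "B \<in> sets \<mu>" for A B
  proof -
    have BF: "B \<inter> F n \<in> sets \<mu>" "emeasure \<mu> (B \<inter> F n) < \<infinity>" for n
    proof -
      show "B \<inter> F n \<in> sets \<mu>" using B F(1) by auto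
      have "emeasure \<mu> (B \<inter> F n) \<le> emeasure \<mu> (F n)" using F(1) by (intro emeasure_mono) auto
      then show "emeasure \<mu> (B \<inter> F n) < \<infinity>" using F(3)[of n] by (simp add: less_top)
    qed
    have inc: "incseq (\<lambda>n. A \<times> (B \<inter> F n))" using F(4) unfolding incseq_def by blast
    have un: "(\<Union>n. A \<times> (B \<inter> F n)) = A \<times> B" using F(2) sets.sets_into_space[OF B] by blast
    have sup: "(SUP n. emeasure (D d) (A \<times> (B \<inter> F n))) = emeasure (D d) (A \<times> B)" for d
      using SUP_emeasure_incseq[OF _ inc, of "D d"] A BF(1) un by (auto simp: D_def)
    show ?thesis
      unfolding sup[symmetric] using rect_fin[OF A BF] by simp
  qed
  have "D ?k = D w"
  proof (rule measure_eqI_generator_eq[OF Int_stable_pair_measure_generator[of \<mu> \<mu>]])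
    let ?E = "{a \<times> b |a b. a \<in> sets \<mu> \<and> b \<in> sets \<mu>}"
    show "?E \<subseteq> Pow (space (\<mu> \<Otimes>\<^sub>M \<mu>))"
      using sets.space_closed[of \<mu>] by (auto simp: space_pair_measure)
    show "sets (D ?k) = sigma_sets (space (\<mu> \<Otimes>\<^sub>M \<mu>)) ?E" "sets (D w) = sigma_sets (space (\<mu> \<Otimes>\<^sub>M \<mu>)) ?E"
      by (simp_all add: D_def sets_pair_measure space_pair_measure)
    show "emeasure (D ?k) X = emeasure (D w) X" if "X \<in> ?E" for X
      using that rect by auto
    show "range (\<lambda>i. F i \<times> F i) \<subseteq> ?E" using F(1) by blast
    show "(\<Union>i. F i \<times> F i) = space (\<mu> \<Otimes>\<^sub>M \<mu>)"
    proof -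
      have "p \<in> (\<Union>i. F i \<times> F i)" if "fst p \<in> space \<mu>" "snd p \<in> space \<mu>" for p
      proof -
        have "fst p \<in> (\<Union>i. F i)" "snd p \<in> (\<Union>i. F i)" using that F(2) by simp_all
        then obtain i j where "fst p \<in> F i" "snd p \<in> F j" by auto
        then have "fst p \<in> F (max i j)" "snd p \<in> F (max i j)"
          using F(4) unfolding incseq_def by (meson max.cobounded1 max.cobounded2 subsetD)+
        then show ?thesis by (intro UN_I[of "max i j"]) (auto simp: mem_Times_iff)
      qed
      then show ?thesis using F(2) by (auto simp: space_pair_measure)
    qed
    show "emeasure (D ?k) (F i \<times> F i) \<noteq> \<infinity>" for i
    proof -
      have Fi[measurable]: "F i \<in> sets \<mu>" using F(1) by auto
      have "emeasure (D ?k) (F i \<times> F i) \<le> (\<integral>\<^sup>+x. ennreal C * indicator (F i) x \<partial>\<mu>)"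
        unfolding emD[OF k3 Fi Fi]
      proof (intro nn_integral_mono_AE, use bound in eventually_elim)
        fix x assume "(\<integral>\<^sup>+y. ennreal (k3 x y) \<partial>\<mu>) \<le> ennreal C"
        moreover have "(\<integral>\<^sup>+y. ennreal (k3 x y) * indicator (F i) y \<partial>\<mu>) \<le> (\<integral>\<^sup>+y. ennreal (k3 x y) \<partial>\<mu>)"
          by (intro nn_integral_mono) (simp add: indicator_def)
        ultimately show "(\<integral>\<^sup>+y. ennreal (k3 x y) * indicator (F i) y \<partial>\<mu>) * indicator (F i) x \<le> ennreal C * indicator (F i) x"
          by (intro mult_right_mono) auto
      qed
      also have "\<dots> = ennreal C * emeasure \<mu> (F i)" by (simp add: nn_integral_cmult_indicator)
      also have "\<dots> < \<infinity>" using F(3)[of i] by (simp add: ennreal_mult_less_top less_top)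
      finally show ?thesis by simp
    qed
  qed
  then have "AE p in \<mu> \<Otimes>\<^sub>M \<mu>. (case p of (x, y) \<Rightarrow> ?k x y) = (case p of (x, y) \<Rightarrow> w x y)"
    unfolding D_def by (subst (asm) pair.P.density_unique_iff) auto
  then have eq: "AE x in \<mu>. AE y in \<mu>. ?k x y = w x y"
    using pair.AE_pair by fastforce
  have n2': "AE y in \<mu>. AE z in \<mu>. 0 \<le> k2 z y"
    using n2 by (subst pair.AE_commute) measurable
  show ?thesis
    using eq n1 n3 AE_space
  proof eventually_elim
    fix x assume eq: "AE y in \<mu>. ?k x y = w x y" and n1: "AE y in \<mu>. 0 \<le> k1 x y"
      and n3: "AE y in \<mu>. 0 \<le> k3 x y" and x: "x \<in> space \<mu>"
    from eq n2' n3 AE_space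
    show "AE y in \<mu>. integrable \<mu> (\<lambda>z. k1 x z * k2 z y) \<and> k3 x y = (LINT z|\<mu>. k1 x z * k2 z y)"
    proof eventually_elim
      fix y assume eq: "?k x y = w x y" and n2: "AE z in \<mu>. 0 \<le> k2 z y" and n3: "0 \<le> k3 x y" and y: "y \<in> space \<mu>"
      have n: "AE z in \<mu>. 0 \<le> k1 x z * k2 z y" using n1 n2 by eventually_elim simp
      have "(\<integral>\<^sup>+z. ennreal (k1 x z * k2 z y) \<partial>\<mu>) = w x y"
        unfolding w_def by (intro nn_integral_cong_AE, use n1 in eventually_elim) (simp add: ennreal_mult')
      then have "(\<integral>\<^sup>+z. ennreal (k1 x z * k2 z y) \<partial>\<mu>) = ennreal (k3 x y)" using eq by simp
      then show "integrable \<mu> (\<lambda>z. k1 x z * k2 z y) \<and> k3 x y = (LINT z|\<mu>. k1 x z * k2 z y)"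
        using x y n n3 by (subst (asm) nn_integral_eq_integrable) (auto)
    qed
  qed
qed

section \<open>Pairing with \<open>L\<^sup>p\<close> and the Feller property\<close>

lemma Linf_I:
  assumes "f \<in> borel_measurable \<mu>" "AE x in \<mu>. norm (f x) \<le> c"
  shows "f \<in> Lp_space \<mu> \<infinity>"
proof -
  have "esssup \<mu> (\<lambda>x. ereal (norm (f x))) \<le> ereal c"
    using assms by (intro esssup_I) auto
  then have "esssup \<mu> (\<lambda>x. ereal (norm (f x))) < \<infinity>"
    by (rule order.strict_trans1) simp
  then show ?thesis
    unfolding Lp_space_def using assms(1) by simp
qed

lemma Linf_D:
  assumes "f \<in> Lp_space \<mu> \<infinity>"
  obtains c where "f \<in> borel_measurable \<mu>" "0 \<le> c" "AE x in \<mu>. norm (f x) \<le> c"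
proof -
  have f: "f \<in> borel_measurable \<mu>" "esssup \<mu> (\<lambda>x. ereal (norm (f x))) < \<infinity>"
    using assms unfolding Lp_space_def by simp_all
  then obtain c where c: "esssup \<mu> (\<lambda>x. ereal (norm (f x))) \<le> ereal c"
    by (cases "esssup \<mu> (\<lambda>x. ereal (norm (f x)))") auto
  have "AE x in \<mu>. norm (f x) \<le> max 0 c"
    using esssup_AE[of "\<lambda>x. ereal (norm (f x))" \<mu>]
  proof eventually_elim
    fix x assume "ereal (norm (f x)) \<le> esssup \<mu> (\<lambda>x. ereal (norm (f x)))"
    then have "ereal (norm (f x)) \<le> ereal c" using c by (rule order_trans)
    then show "norm (f x) \<le> max 0 c" by simp
  qed
  with f(1) show ?thesis by (intro that[of "max 0 c"]) auto
qed

text \<open>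
  An integrable and bounded weight \<open>b\<close> lies in every dual \<open>L\<^sup>p\<^sup>'\<close>, so it pairs with the unit ball of
  \<open>L\<^sup>p\<close> boundedly. For finite \<open>p\<close> the elementary inequality \<open>r \<le> 1 + r\<^sup>p\<close> replaces Hoelder's.
\<close>

lemma weighted_integral_bound_Lp:
  fixes b :: "'a \<Rightarrow> real" and p :: ennreal
  assumes b: "integrable \<mu> b" "\<And>x. 0 \<le> b x" "\<And>x. b x \<le> c" and p: "1 \<le> p"
  shows "\<exists>K>0. \<forall>f::'a \<Rightarrow> 'b::{banach,second_countable_topology}. f \<in> Lp_space \<mu> p \<longrightarrow> Lp_norm \<mu> p f \<le> 1 \<longrightarrow>
    integrable \<mu> (\<lambda>x. b x * norm (f x)) \<and> (LINT x|\<mu>. b x * norm (f x)) \<le> K"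
proof -
  note [measurable] = borel_measurable_integrable[OF b(1)]
  let ?K = "(LINT x|\<mu>. b x) + \<bar>c\<bar> + 1"
  have B: "0 \<le> (LINT x|\<mu>. b x)" using b by simp
  have "integrable \<mu> (\<lambda>x. b x * norm (f x)) \<and> (LINT x|\<mu>. b x * norm (f x)) \<le> ?K"
    if f: "f \<in> Lp_space \<mu> p" "Lp_norm \<mu> p f \<le> 1" for f :: "'a \<Rightarrow> 'b"
  proof (cases "p = \<infinity>")
    case True
    have [measurable]: "f \<in> borel_measurable \<mu>" using f unfolding Lp_space_def by simp
    let ?e = "esssup \<mu> (\<lambda>x. ereal (norm (f x)))"
    have "?e < \<infinity>" "real_of_ereal ?e \<le> 1"
      using f True unfolding Lp_space_def Lp_norm_def by simp_all
    then have e: "?e \<le> 1" by (cases ?e) auto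
    have le: "AE x in \<mu>. b x * norm (f x) \<le> b x"
      using esssup_AE[of "\<lambda>x. ereal (norm (f x))" \<mu>]
    proof eventually_elim
      fix x assume "ereal (norm (f x)) \<le> ?e"
      then have "ereal (norm (f x)) \<le> 1" using e by (rule order_trans)
      then show "b x * norm (f x) \<le> b x" using b(2)[of x] by (simp add: mult_left_le)
    qed
    have i: "integrable \<mu> (\<lambda>x. b x * norm (f x))"
      by (rule Bochner_Integration.integrable_bound[OF b(1)]) (use le b(2) in auto)
    have "(LINT x|\<mu>. b x * norm (f x)) \<le> (LINT x|\<mu>. b x)"
      using i b(1) le by (rule integral_mono_AE)
    then show ?thesis using i by simp
  next
    case False
    define q where "q = enn2real p"
    have q: "1 \<le> q" using p False unfolding q_def
      by (metis enn2real_1 enn2real_mono infinity_ennreal_def less_top)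
    have [measurable]: "f \<in> borel_measurable \<mu>" using f unfolding Lp_space_def by simp
    have i: "integrable \<mu> (\<lambda>x. norm (f x) powr q)" and n: "(LINT x|\<mu>. norm (f x) powr q) powr (1 / q) \<le> 1"
      using f False unfolding Lp_space_def Lp_norm_def q_def by simp_all
    have I: "(LINT x|\<mu>. norm (f x) powr q) \<le> 1"
    proof (rule ccontr)
      assume "\<not> ?thesis"
      then have "1 < (LINT x|\<mu>. norm (f x) powr q) powr (1 / q)" using q by (intro gr_one_powr) auto
      with n show False by simp
    qed
    have le: "b x * norm (f x) \<le> b x + \<bar>c\<bar> * norm (f x) powr q" for x
    proof (cases "norm (f x) \<le> 1")
      case True
      then have "b x * norm (f x) \<le> b x" using b(2)[of x] by (simp add: mult_left_le)
      moreover have "0 \<le> \<bar>c\<bar> * norm (f x) powr q" by simp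
      ultimately show ?thesis by linarith
    next
      case False
      then have "norm (f x) \<le> norm (f x) powr q" using q powr_mono[of 1 q "norm (f x)"] by simp
      moreover have "b x \<le> \<bar>c\<bar>" using b(3)[of x] by simp
      ultimately have "b x * norm (f x) \<le> \<bar>c\<bar> * norm (f x) powr q" by (intro mult_mono) auto
      then show ?thesis using b(2)[of x] by simp
    qed
    have j: "integrable \<mu> (\<lambda>x. b x + \<bar>c\<bar> * norm (f x) powr q)" using b(1) i by simp
    have i': "integrable \<mu> (\<lambda>x. b x * norm (f x))"
      by (rule Bochner_Integration.integrable_bound[OF j]) (use le b(2) in \<open>auto simp: abs_mult intro: order_trans[OF _ abs_ge_self]\<close>)
    have "(LINT x|\<mu>. b x * norm (f x)) \<le> (LINT x|\<mu>. b x + \<bar>c\<bar> * norm (f x) powr q)"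
      using i' j le by (rule integral_mono)
    also have "\<dots> = (LINT x|\<mu>. b x) + \<bar>c\<bar> * (LINT x|\<mu>. norm (f x) powr q)" using b(1) i by simp
    also have "\<dots> \<le> ?K" using I by (simp add: mult_left_le add_increasing2)
    finally show ?thesis using i' by simp
  qed
  then show ?thesis using B by (intro exI[of _ ?K]) auto
qed

lemma Cb_op_eqI:
  assumes "sets \<mu> = sets borel" "full_support \<mu>" "is_Cb_version \<mu> (kernel_op \<mu> k f) g"
  shows "Cb_op \<mu> k f = g"
  unfolding Cb_op_def by (rule Cb_version_eqI[OF assms])

lemma const_one_in_Linf: "(\<lambda>_. 1::complex) \<in> Lp_space \<mu> \<infinity>"
  by (rule Linf_I[where c = 1]) auto

lemma strong_Feller_integrable:
  assumes "strong_Feller \<mu> u" "t > 0"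
  shows "AE x in \<mu>. integrable \<mu> (u t x)"
proof -
  have "kernel_integrable \<mu> (u t) (\<lambda>_. 1::complex)"
    using assms const_one_in_Linf unfolding strong_Feller_def by blast
  then show ?thesis unfolding kernel_integrable_def
    by eventually_elim (simp add: scaleR_conv_of_real complex_of_real_integrable_eq)
qed

text \<open>
  \<open>U\<^sub>t 1\<close> appears both as a real and as a complex function; the Feller property is about the complex
  one, and the two continuous versions are identified here.
\<close>

lemma strong_Feller_one:
  fixes u :: "real \<Rightarrow> 'a::polish_space \<Rightarrow> 'a \<Rightarrow> real"
  assumes borel: "sets \<mu> = sets borel" and supp: "full_support \<mu>"
    and Feller: "strong_Feller \<mu> u" and t: "t > 0" and nonneg: "AE x in \<mu>. AE y in \<mu>. 0 \<le> u t x y"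
  defines "a \<equiv> Cb_op \<mu> (u t) (\<lambda>_. 1::real)"
  shows "continuous_on UNIV a"
    and "bounded (range a)"
    and "AE x in \<mu>. a x = (LINT y|\<mu>. u t x y)"
    and "\<And>x. 0 \<le> a x"
    and "Cb_op \<mu> (u t) (\<lambda>_. 1) = (\<lambda>x. complex_of_real (a x))"
proof -
  let ?g = "Cb_op \<mu> (u t) (\<lambda>_. 1::complex)"
  obtain g0 where "is_Cb_version \<mu> (kernel_op \<mu> (u t) (\<lambda>_. 1::complex)) g0"
    using Feller t const_one_in_Linf unfolding strong_Feller_def by blast
  from this[folded Cb_op_eqI[OF borel supp this]] have g: "continuous_on UNIV ?g" "bounded (range ?g)"
    "AE x in \<mu>. ?g x = complex_of_real (LINT y|\<mu>. u t x y)"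
    unfolding is_Cb_version_def kernel_op_def by (simp_all add: scaleR_conv_of_real)
  have Re_version: "is_Cb_version \<mu> (kernel_op \<mu> (u t) (\<lambda>_. 1::real)) (\<lambda>x. Re (?g x))"
    unfolding is_Cb_version_def kernel_op_def
  proof (intro conjI)
    show "continuous_on UNIV (\<lambda>x. Re (?g x))" using g(1) by (intro continuous_intros)
    show "bounded (range (\<lambda>x. Re (?g x)))"
      using g(2) unfolding bounded_iff by (auto intro: order_trans[OF abs_Re_le_cmod])
    show "AE x in \<mu>. Re (?g x) = (LINT y|\<mu>. u t x y *\<^sub>R 1)"
      using g(3) by eventually_elim simp
  qed
  have v: "is_Cb_version \<mu> (kernel_op \<mu> (u t) (\<lambda>_. 1::real)) a"
    using Re_version Cb_op_eqI[OF borel supp Re_version] unfolding a_def by simp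
  show c: "continuous_on UNIV a" and "bounded (range a)"
    and ae: "AE x in \<mu>. a x = (LINT y|\<mu>. u t x y)"
    using v unfolding is_Cb_version_def kernel_op_def by simp_all
  have "AE x in \<mu>. 0 \<le> a x"
    using ae nonneg by eventually_elim (simp add: integral_nonneg_AE)
  then show "0 \<le> a x" for x
    by (rule AE_closed_imp_everywhere[OF borel supp, rotated]) (intro closed_Collect_le continuous_intros c)
  have "AE x in \<mu>. ?g x = complex_of_real (a x)"
    using ae g(3) by eventually_elim simp
  then show "?g = (\<lambda>x. complex_of_real (a x))"
    by (intro ext, rule AE_closed_imp_everywhere[OF borel supp, rotated])
      (intro closed_Collect_eq continuous_intros c g(1))
qed

section \<open>Kernel semigroups converging to a rank-one kernel\<close>

text \<open>
  The hypotheses in the form in which they are used, namely as statements about kernels that hold for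
  almost every \<open>x\<close> and then almost every \<open>y\<close>. They are symmetric under the exchange of the kernel with
  its adjoint and of \<open>\<phi>\<close> with \<open>\<psi>\<close> (lemma \<open>adjoint\<close>), so that each result about \<open>u\<close> also holds for
  \<open>adj_kernel u\<close>. The eigenvalue equations for \<open>\<phi>\<close> and \<open>\<psi>\<close> are consequences of the convergence
  bound (lemma \<open>eigenfunction\<close>).
\<close>

locale ergodic_kernel_semigroup =
  fixes \<mu> :: "'a::polish_space measure" and u :: "real \<Rightarrow> 'a \<Rightarrow> 'a \<Rightarrow> real"
    and \<phi> \<psi> :: "'a \<Rightarrow> real" and l \<gamma> L C0 t0 t1 :: real
  assumes borel: "sets \<mu> = sets borel" and sigma_finite: "sigma_finite_measure \<mu>"
    and supp: "full_support \<mu>"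
    and meas: "\<And>t. t > 0 \<Longrightarrow> (\<lambda>(x, y). u t x y) \<in> borel_measurable (\<mu> \<Otimes>\<^sub>M \<mu>)"
    and nonneg: "\<And>t. t > 0 \<Longrightarrow> AE x in \<mu>. AE y in \<mu>. 0 \<le> u t x y"
    and composition: "\<And>s t. s > 0 \<Longrightarrow> t > 0 \<Longrightarrow> AE x in \<mu>. AE y in \<mu>.
      integrable \<mu> (\<lambda>z. u s x z * u t z y) \<and> u (s + t) x y = (LINT z|\<mu>. u s x z * u t z y)"
    and Feller: "strong_Feller \<mu> u" and Feller_adj: "strong_Feller \<mu> (adj_kernel u)"
    and \<phi>_cont: "continuous_on UNIV \<phi>" and \<phi>_bdd: "bounded (range \<phi>)" and \<phi>_pos: "AE x in \<mu>. 0 < \<phi> x"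
    and \<psi>_cont: "continuous_on UNIV \<psi>" and \<psi>_bdd: "bounded (range \<psi>)" and \<psi>_pos: "AE x in \<mu>. 0 < \<psi> x"
    and L_pos: "0 < L" and \<gamma>_pos: "0 < \<gamma>" and C0_pos: "0 < C0" and t0_pos: "0 < t0" and t1_ge: "t0 \<le> t1"
    and convergence: "\<And>t. 2 * t0 < t \<Longrightarrow> AE x in \<mu>. AE y in \<mu>.
      \<bar>exp (l * t) * u t x y - \<phi> x * \<psi> y / L\<bar> \<le> C0 * exp (- \<gamma> * t)"
    and heat: "integrable (\<mu> \<Otimes>\<^sub>M \<mu>) (\<lambda>(x, y). u t1 x y)"

sublocale ergodic_kernel_semigroup \<subseteq> sigma_finite_measure \<mu>
  by (rule sigma_finite)

sublocale ergodic_kernel_semigroup \<subseteq> pair: pair_sigma_finite \<mu> \<mu>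
  by standard

context ergodic_kernel_semigroup
begin

lemma t1_pos: "0 < t1" using t0_pos t1_ge by simp

lemma space_UNIV: "space \<mu> = UNIV"
  using borel by (metis sets_eq_imp_space_eq space_borel)

lemma meas_u [measurable (raw)]:
  assumes "t > 0" "f \<in> measurable M \<mu>" "g \<in> measurable M \<mu>"
  shows "(\<lambda>z. u t (f z) (g z)) \<in> borel_measurable M"
  using measurable_Pair_compose_split[OF meas[OF assms(1)] assms(2,3)] .

lemma meas_cont: "continuous_on UNIV f \<Longrightarrow> f \<in> borel_measurable \<mu>"
  for f :: "'a \<Rightarrow> 'b::topological_space"
  using borel_measurable_continuous_onI[of f] measurable_cong_sets[OF borel refl, of "borel :: 'b measure"] by simp

lemma meas_\<phi> [measurable]: "\<phi> \<in> borel_measurable \<mu>" by (rule meas_cont[OF \<phi>_cont])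
lemma meas_\<psi> [measurable]: "\<psi> \<in> borel_measurable \<mu>" by (rule meas_cont[OF \<psi>_cont])

lemma meas_kernel_op:
  fixes f :: "'a \<Rightarrow> 'b::{banach,second_countable_topology}"
  assumes t: "t > 0" and [measurable]: "f \<in> borel_measurable \<mu>"
  shows "kernel_op \<mu> (u t) f \<in> borel_measurable \<mu>"
proof -
  have "(\<lambda>x. LINT y|\<mu>. u t x y *\<^sub>R f y) \<in> borel_measurable \<mu>"
    using t by measurable
  then show ?thesis unfolding kernel_op_def[abs_def] .
qed

lemma AE_ex: "AE x in \<mu>. P x \<Longrightarrow> \<exists>x. P x"
  using AE_closed_imp_everywhere[OF borel supp, of "\<lambda>_. False"] eventually_mono[of P _ "\<lambda>_. False"] by auto

lemma everywhere: "AE x in \<mu>. P x \<Longrightarrow> closed {x. P x} \<Longrightarrow> P x"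
  using AE_closed_imp_everywhere[OF borel supp] by blast

lemma \<phi>_nonneg: "0 \<le> \<phi> x"
  by (rule everywhere) (use \<phi>_pos in \<open>auto elim: eventually_mono intro!: closed_Collect_le \<phi>_cont continuous_intros\<close>)

lemma \<psi>_nonneg: "0 \<le> \<psi> x"
  by (rule everywhere) (use \<psi>_pos in \<open>auto elim: eventually_mono intro!: closed_Collect_le \<psi>_cont continuous_intros\<close>)

lemma \<phi>_bound: obtains c where "0 < c" "\<And>x. \<phi> x \<le> c"
proof -
  obtain c where "0 < c" "\<forall>x\<in>range \<phi>. norm x \<le> c" using \<phi>_bdd bounded_pos by metis
  then show ?thesis by (intro that[of c]) (auto intro: order_trans[OF abs_ge_self])
qed

lemma adjoint: "ergodic_kernel_semigroup \<mu> (adj_kernel u) \<psi> \<phi> l \<gamma> L C0 t0 t1"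
proof (rule ergodic_kernel_semigroup.intro)
  show "sets \<mu> = sets borel" "full_support \<mu>" "0 < L" "0 < \<gamma>" "0 < C0" "0 < t0" "t0 \<le> t1"
    "continuous_on UNIV \<psi>" "bounded (range \<psi>)" "AE x in \<mu>. 0 < \<psi> x"
    "continuous_on UNIV \<phi>" "bounded (range \<phi>)" "AE x in \<mu>. 0 < \<phi> x"
    "strong_Feller \<mu> (adj_kernel u)"
    by (fact borel supp L_pos \<gamma>_pos C0_pos t0_pos t1_ge \<phi>_cont \<phi>_bdd \<phi>_pos \<psi>_cont \<psi>_bdd \<psi>_pos Feller_adj)+
  have "adj_kernel (adj_kernel u) = u" by (intro ext) (simp add: adj_kernel_def)
  then show "strong_Feller \<mu> (adj_kernel (adj_kernel u))" using Feller by simp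
  show "sigma_finite_measure \<mu>" by (rule sigma_finite)
  show "(\<lambda>(x, y). adj_kernel u t x y) \<in> borel_measurable (\<mu> \<Otimes>\<^sub>M \<mu>)" if "t > 0" for t
    unfolding adj_kernel_def using that by measurable
  show "AE x in \<mu>. AE y in \<mu>. 0 \<le> adj_kernel u t x y" if "t > 0" for t
    using nonneg[OF that] that unfolding adj_kernel_def by (subst pair.AE_commute) measurable
  show "AE x in \<mu>. AE y in \<mu>. integrable \<mu> (\<lambda>z. adj_kernel u s x z * adj_kernel u t z y)
      \<and> adj_kernel u (s + t) x y = (LINT z|\<mu>. adj_kernel u s x z * adj_kernel u t z y)"
    if "s > 0" "t > 0" for s t
  proof -
    have "AE y in \<mu>. AE x in \<mu>. integrable \<mu> (\<lambda>z. u s z x * u t y z) \<and> u (s + t) y x = (LINT z|\<mu>. u s z x * u t y z)"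
      using composition[OF that(2,1)] by (simp add: mult.commute add.commute)
    then show ?thesis
      unfolding adj_kernel_def using that by (subst pair.AE_commute) measurable
  qed
  show "AE x in \<mu>. AE y in \<mu>. \<bar>exp (l * t) * adj_kernel u t x y - \<psi> x * \<phi> y / L\<bar> \<le> C0 * exp (- \<gamma> * t)"
    if "2 * t0 < t" for t
    using convergence[OF that] t0_pos that unfolding adj_kernel_def
    by (subst pair.AE_commute) (measurable, simp add: mult.commute)
  show "integrable (\<mu> \<Otimes>\<^sub>M \<mu>) (\<lambda>(x, y). adj_kernel u t1 x y)"
    using pair.integrable_product_swap[OF heat] unfolding adj_kernel_def by simp
qed

abbreviation survival :: "real \<Rightarrow> 'a \<Rightarrow> real" where
  "survival t \<equiv> Cb_op \<mu> (u t) (\<lambda>_. 1)"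

abbreviation survival_adj :: "real \<Rightarrow> 'a \<Rightarrow> real" where
  "survival_adj t \<equiv> Cb_op \<mu> (adj_kernel u t) (\<lambda>_. 1)"

lemma Cb_op_version:
  "is_Cb_version \<mu> (kernel_op \<mu> k f) g \<Longrightarrow> is_Cb_version \<mu> (kernel_op \<mu> k f) (Cb_op \<mu> k f)"
  using Cb_op_eqI[OF borel supp] by metis

lemma Cb_op_Linf:
  fixes f :: "'a \<Rightarrow> complex"
  assumes "t > 0" "f \<in> Lp_space \<mu> \<infinity>"
  shows "is_Cb_version \<mu> (kernel_op \<mu> (u t) f) (Cb_op \<mu> (u t) f)"
  using Feller assms Cb_op_version unfolding strong_Feller_def by blast

lemmas integrable_u = strong_Feller_integrable[OF Feller]

lemma survival:
  assumes t: "t > 0"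
  shows survival_cont: "continuous_on UNIV (survival t)"
    and survival_bdd: "bounded (range (survival t))"
    and survival_AE: "AE x in \<mu>. survival t x = (LINT y|\<mu>. u t x y)"
    and survival_nonneg: "\<And>x. 0 \<le> survival t x"
    and survival_complex: "Cb_op \<mu> (u t) (\<lambda>_. 1) = (\<lambda>x. complex_of_real (survival t x))"
  using strong_Feller_one[OF borel supp Feller t nonneg[OF t]] by auto

lemma integrable_u_bounded:
  fixes f :: "'a \<Rightarrow> 'b::{banach,second_countable_topology}"
  assumes t: "t > 0" and [measurable]: "f \<in> borel_measurable \<mu>" and f: "AE y in \<mu>. norm (f y) \<le> c"
  shows "AE x in \<mu>. integrable \<mu> (\<lambda>y. u t x y *\<^sub>R f y) \<and> norm (kernel_op \<mu> (u t) f x) \<le> c * survival t x"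
  using integrable_u[OF t] nonneg[OF t] survival_AE[OF t] AE_space
proof eventually_elim
  fix x assume i: "integrable \<mu> (u t x)" and n: "AE y in \<mu>. 0 \<le> u t x y"
    and s: "survival t x = (LINT y|\<mu>. u t x y)" and x: "x \<in> space \<mu>"
  have le: "AE y in \<mu>. norm (u t x y *\<^sub>R f y) \<le> c * u t x y"
    using n f by eventually_elim (simp add: mult.commute mult_right_mono)
  have ic: "integrable \<mu> (\<lambda>y. c * u t x y)" using i by simp
  have [measurable]: "(\<lambda>y. u t x y *\<^sub>R f y) \<in> borel_measurable \<mu>" using t x by measurable
  have int: "integrable \<mu> (\<lambda>y. u t x y *\<^sub>R f y)"
    by (rule Bochner_Integration.integrable_bound[OF ic])
      (use le in \<open>auto elim!: eventually_mono intro: order_trans[OF _ abs_ge_self]\<close>)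
  have "norm (kernel_op \<mu> (u t) f x) \<le> (LINT y|\<mu>. norm (u t x y *\<^sub>R f y))"
    unfolding kernel_op_def by (rule integral_norm_bound)
  also have "\<dots> \<le> (LINT y|\<mu>. c * u t x y)"
    by (rule integral_mono_AE[OF integrable_norm[OF int] ic le])
  finally have "norm (kernel_op \<mu> (u t) f x) \<le> (LINT y|\<mu>. c * u t x y)" .
  then show "integrable \<mu> (\<lambda>y. u t x y *\<^sub>R f y) \<and> norm (kernel_op \<mu> (u t) f x) \<le> c * survival t x"
    using int s by simp
qed

section \<open>The weighted convergence estimate\<close>

text \<open>
  Composition with \<open>U\<^sub>s\<close> from the left turns the factor \<open>a(z)\<close> of an error bound into \<open>U\<^sub>s a(x)\<close> and
  leaves \<open>b\<close> alone; the adjoint version acts on \<open>b\<close> instead. The value of \<open>U\<^sub>s \<phi>\<close> is kept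
  unevaluated because this lemma is what identifies it.
\<close>

lemma compose_estimate:
  assumes s: "s > 0" and r: "r > 0" and [measurable]: "a \<in> borel_measurable \<mu>" "b \<in> borel_measurable \<mu>"
    and a: "\<And>z. \<bar>a z\<bar> \<le> c"
    and est: "AE z in \<mu>. AE y in \<mu>. \<bar>exp (l * r) * u r z y - \<phi> z * \<psi> y / L\<bar> \<le> a z * b y"
  shows "AE x in \<mu>. AE y in \<mu>. \<bar>exp (l * r) * u (s + r) x y - kernel_op \<mu> (u s) \<phi> x * \<psi> y / L\<bar>
    \<le> kernel_op \<mu> (u s) a x * b y"
proof -
  have est': "AE y in \<mu>. AE z in \<mu>. \<bar>exp (l * r) * u r z y - \<phi> z * \<psi> y / L\<bar> \<le> a z * b y"
    using est r by (subst pair.AE_commute) measurable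
  obtain d where d: "\<And>x. norm (\<phi> x) \<le> d" using \<phi>_bdd unfolding bounded_iff by auto
  have ia: "AE x in \<mu>. integrable \<mu> (\<lambda>z. u s x z * a z)"
    using integrable_u_bounded[OF s, of a c] a by (auto elim: eventually_mono)
  have ip: "AE x in \<mu>. integrable \<mu> (\<lambda>z. u s x z * \<phi> z)"
    using integrable_u_bounded[OF s, of \<phi> d] d by (auto elim: eventually_mono)
  show ?thesis using composition[OF s r] nonneg[OF s] ia ip
  proof eventually_elim
    fix x
    assume comp: "AE y in \<mu>. integrable \<mu> (\<lambda>z. u s x z * u r z y) \<and> u (s + r) x y = (LINT z|\<mu>. u s x z * u r z y)"
      and n: "AE y in \<mu>. 0 \<le> u s x y"
      and ia: "integrable \<mu> (\<lambda>z. u s x z * a z)" and ip: "integrable \<mu> (\<lambda>z. u s x z * \<phi> z)"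
    from comp est'
    show "AE y in \<mu>. \<bar>exp (l * r) * u (s + r) x y - kernel_op \<mu> (u s) \<phi> x * \<psi> y / L\<bar> \<le> kernel_op \<mu> (u s) a x * b y"
    proof eventually_elim
      fix y
      assume comp: "integrable \<mu> (\<lambda>z. u s x z * u r z y) \<and> u (s + r) x y = (LINT z|\<mu>. u s x z * u r z y)"
        and est: "AE z in \<mu>. \<bar>exp (l * r) * u r z y - \<phi> z * \<psi> y / L\<bar> \<le> a z * b y"
      let ?d = "\<lambda>z. exp (l * r) * (u s x z * u r z y) - (u s x z * \<phi> z) * (\<psi> y / L)"
      have i: "integrable \<mu> ?d" using comp ip by simp
      have ib: "integrable \<mu> (\<lambda>z. (u s x z * a z) * b y)" using ia by simp
      have "exp (l * r) * u (s + r) x y - kernel_op \<mu> (u s) \<phi> x * \<psi> y / L = (LINT z|\<mu>. ?d z)"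
        using comp ip by (simp add: kernel_op_def)
      then have "\<bar>exp (l * r) * u (s + r) x y - kernel_op \<mu> (u s) \<phi> x * \<psi> y / L\<bar> \<le> (LINT z|\<mu>. \<bar>?d z\<bar>)"
        using integral_abs_bound[of \<mu> ?d] by simp
      also have "\<dots> \<le> (LINT z|\<mu>. (u s x z * a z) * b y)"
      proof (rule integral_mono_AE)
        show "AE z in \<mu>. \<bar>?d z\<bar> \<le> (u s x z * a z) * b y"
          using n est
        proof eventually_elim
          fix z assume p: "0 \<le> u s x z" and e: "\<bar>exp (l * r) * u r z y - \<phi> z * \<psi> y / L\<bar> \<le> a z * b y"
          have "\<bar>?d z\<bar> = u s x z * \<bar>exp (l * r) * u r z y - \<phi> z * \<psi> y / L\<bar>"
          proof -
            have "?d z = u s x z * (exp (l * r) * u r z y - \<phi> z * \<psi> y / L)" by (simp add: algebra_simps)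
            then show ?thesis using p by (simp add: abs_mult)
          qed
          also have "\<dots> \<le> u s x z * (a z * b y)" using e p by (rule mult_left_mono)
          finally show "\<bar>?d z\<bar> \<le> (u s x z * a z) * b y" by (simp add: mult.assoc)
        qed
      qed (use i ib in auto)
      also have "\<dots> = kernel_op \<mu> (u s) a x * b y" using ia by (simp add: kernel_op_def)
      finally show "\<bar>exp (l * r) * u (s + r) x y - kernel_op \<mu> (u s) \<phi> x * \<psi> y / L\<bar> \<le> kernel_op \<mu> (u s) a x * b y" .
    qed
  qed
qed

text \<open>
  By the semigroup law, \<open>exp(l (s + r)) u\<^sub>s\<^sub>+\<^sub>r(x, y)\<close> is close for large \<open>r\<close> both to
  \<open>\<phi>(x) \<psi>(y) / L\<close> and to \<open>exp(l s) (U\<^sub>s \<phi>)(x) \<psi>(y) / L\<close>, with errors of order \<open>exp(- \<gamma> r)\<close>. Letting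
  \<open>r\<close> run to infinity through a sequence at one \<open>y\<close> with \<open>\<psi>(y) > 0\<close> forces equality.
\<close>

lemma eigenfunction:
  assumes s: "s > 0"
  shows "AE x in \<mu>. kernel_op \<mu> (u s) \<phi> x = exp (- l * s) * \<phi> x"
proof -
  \<comment> \<open>A countable set of times, so that one null set serves all of them.\<close>
  define n where "n i = 2 * t0 + 1 + real i" for i
  have n: "n i > 2 * t0" "n i > 0" "s + n i > 2 * t0" for i using t0_pos s unfolding n_def by auto
  have A: "AE x in \<mu>. \<forall>i. AE y in \<mu>. \<bar>exp (l * n i) * u (s + n i) x y - kernel_op \<mu> (u s) \<phi> x * \<psi> y / L\<bar>
      \<le> kernel_op \<mu> (u s) (\<lambda>_. 1) x * (C0 * exp (- \<gamma> * n i))"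
    unfolding AE_all_countable
    using compose_estimate[OF s n(2), of "\<lambda>_. 1" "\<lambda>_. C0 * exp (- \<gamma> * n i)" 1 for i] convergence[OF n(1)] by simp
  have B: "AE x in \<mu>. \<forall>i. AE y in \<mu>. \<bar>exp (l * (s + n i)) * u (s + n i) x y - \<phi> x * \<psi> y / L\<bar> \<le> C0 * exp (- \<gamma> * (s + n i))"
    unfolding AE_all_countable using convergence[OF n(3)] by simp
  show ?thesis using A B
  proof eventually_elim
    fix x
    assume A: "\<forall>i. AE y in \<mu>. \<bar>exp (l * n i) * u (s + n i) x y - kernel_op \<mu> (u s) \<phi> x * \<psi> y / L\<bar>
        \<le> kernel_op \<mu> (u s) (\<lambda>_. 1) x * (C0 * exp (- \<gamma> * n i))"
      and B: "\<forall>i. AE y in \<mu>. \<bar>exp (l * (s + n i)) * u (s + n i) x y - \<phi> x * \<psi> y / L\<bar> \<le> C0 * exp (- \<gamma> * (s + n i))"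
    define U where "U = kernel_op \<mu> (u s) \<phi> x"
    define V where "V = kernel_op \<mu> (u s) (\<lambda>_. 1::real) x"
    from A B have "AE y in \<mu>. (\<forall>i. \<bar>exp (l * n i) * u (s + n i) x y - U * \<psi> y / L\<bar> \<le> V * (C0 * exp (- \<gamma> * n i)))
      \<and> (\<forall>i. \<bar>exp (l * (s + n i)) * u (s + n i) x y - \<phi> x * \<psi> y / L\<bar> \<le> C0 * exp (- \<gamma> * (s + n i))) \<and> 0 < \<psi> y"
      using \<psi>_pos by (simp add: AE_all_countable U_def V_def)
    then obtain y where y: "\<And>i. \<bar>exp (l * n i) * u (s + n i) x y - U * \<psi> y / L\<bar> \<le> V * (C0 * exp (- \<gamma> * n i))"
      "\<And>i. \<bar>exp (l * (s + n i)) * u (s + n i) x y - \<phi> x * \<psi> y / L\<bar> \<le> C0 * exp (- \<gamma> * (s + n i))" "0 < \<psi> y"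
      using AE_ex by blast
    have le: "\<bar>exp (l * s) * U - \<phi> x\<bar> * (\<psi> y / L) \<le> (exp (l * s) * V * C0 + C0 * exp (- \<gamma> * s)) * exp (- \<gamma> * n i)" for i
    proof -
      have E: "(exp (l * s) * U - \<phi> x) * (\<psi> y / L)
        = (exp (l * (s + n i)) * u (s + n i) x y - \<phi> x * \<psi> y / L)
          - exp (l * s) * (exp (l * n i) * u (s + n i) x y - U * \<psi> y / L)"
        by (simp add: algebra_simps exp_add)
      have "\<bar>exp (l * s) * U - \<phi> x\<bar> * (\<psi> y / L) = \<bar>(exp (l * s) * U - \<phi> x) * (\<psi> y / L)\<bar>"
        using y(3) L_pos by (simp add: abs_mult)
      also have "\<dots> \<le> \<bar>exp (l * (s + n i)) * u (s + n i) x y - \<phi> x * \<psi> y / L\<bar>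
          + exp (l * s) * \<bar>exp (l * n i) * u (s + n i) x y - U * \<psi> y / L\<bar>"
        unfolding E by (rule order_trans[OF abs_triangle_ineq4]) (simp add: abs_mult)
      also have "\<dots> \<le> C0 * exp (- \<gamma> * (s + n i)) + exp (l * s) * (V * (C0 * exp (- \<gamma> * n i)))"
        using y(1,2) by (intro add_mono mult_left_mono) auto
      also have "\<dots> = (exp (l * s) * V * C0 + C0 * exp (- \<gamma> * s)) * exp (- \<gamma> * n i)"
        by (simp add: algebra_simps exp_add exp_diff exp_minus field_simps)
      finally show ?thesis .
    qed
    have "(\<lambda>i. exp (- \<gamma> * n i)) \<longlonglongrightarrow> 0"
    proof -
      have "filterlim (\<lambda>i. \<gamma> * n i) at_top sequentially"
        unfolding n_def using \<gamma>_pos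
        by (intro filterlim_tendsto_pos_mult_at_top[OF tendsto_const] filterlim_tendsto_add_at_top[OF tendsto_const] filterlim_real_sequentially) auto
      then have "filterlim (\<lambda>i. - (\<gamma> * n i)) at_bot sequentially"
        by (simp add: filterlim_uminus_at_top)
      then show ?thesis using filterlim_compose[OF exp_at_bot] by simp
    qed
    then have "(\<lambda>i. (exp (l * s) * V * C0 + C0 * exp (- \<gamma> * s)) * exp (- \<gamma> * n i)) \<longlonglongrightarrow> 0"
      using tendsto_mult_right_zero by blast
    then have "\<bar>exp (l * s) * U - \<phi> x\<bar> * (\<psi> y / L) \<le> 0"
      by (rule LIMSEQ_le_const) (use le in blast)
    then have "\<bar>exp (l * s) * U - \<phi> x\<bar> \<le> 0"
      using divide_pos_pos[OF y(3) L_pos] by (meson mult_pos_pos not_le)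
    then have "exp (l * s) * U = \<phi> x" by simp
    then have "U = exp (- l * s) * \<phi> x" by (simp add: exp_minus field_simps)
    then show "kernel_op \<mu> (u s) \<phi> x = exp (- l * s) * \<phi> x" unfolding U_def .
  qed
qed

lemma adj_eigenfunction:
  assumes "s > 0"
  shows "AE y in \<mu>. kernel_op \<mu> (adj_kernel u s) \<psi> y = exp (- l * s) * \<psi> y"
proof -
  interpret adj: ergodic_kernel_semigroup \<mu> "adj_kernel u" \<psi> \<phi> l \<gamma> L C0 t0 t1 by (rule adjoint)
  show ?thesis by (rule adj.eigenfunction[OF assms])
qed

lemma survival_adj:
  shows survival_adj_cont: "continuous_on UNIV (survival_adj t1)"
    and survival_adj_bdd: "bounded (range (survival_adj t1))"
    and survival_adj_nonneg: "\<And>y. 0 \<le> survival_adj t1 y"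
    and survival_adj_AE: "AE y in \<mu>. survival_adj t1 y = (LINT x|\<mu>. u t1 x y)"
proof -
  interpret adj: ergodic_kernel_semigroup \<mu> "adj_kernel u" \<psi> \<phi> l \<gamma> L C0 t0 t1 by (rule adjoint)
  show "continuous_on UNIV (survival_adj t1)" "bounded (range (survival_adj t1))"
    "\<And>y. 0 \<le> survival_adj t1 y" "AE y in \<mu>. survival_adj t1 y = (LINT x|\<mu>. u t1 x y)"
    using adj.survival[OF t1_pos] by (simp_all add: adj_kernel_def)
qed

lemma survival_bound:
  assumes "t > 0" obtains c where "0 < c" "\<And>x. survival t x \<le> c"
proof -
  obtain c where "0 < c" "\<forall>x\<in>range (survival t). norm x \<le> c" using survival_bdd[OF assms] bounded_pos by metis
  then show ?thesis by (intro that[of c]) (auto intro: order_trans[OF abs_ge_self])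
qed

lemma survival_adj_bound:
  obtains c where "0 < c" "\<And>y. survival_adj t1 y \<le> c"
proof -
  obtain c where "0 < c" "\<forall>x\<in>range (survival_adj t1). norm x \<le> c" using survival_adj_bdd bounded_pos by metis
  then show ?thesis by (intro that[of c]) (auto intro: order_trans[OF abs_ge_self])
qed

lemma meas_survival [measurable]: "t > 0 \<Longrightarrow> survival t \<in> borel_measurable \<mu>"
  by (rule meas_cont[OF survival_cont])

lemma meas_survival_adj [measurable]: "survival_adj t1 \<in> borel_measurable \<mu>"
  by (rule meas_cont[OF survival_adj_cont])

text \<open>
  The double integral of \<open>u\<^sub>t\<^sub>1\<close> is the heat content, and \<open>U\<^sub>t\<^sub>1\<^sup>* 1\<close> is its inner integral in \<open>x\<close>.
\<close>

lemma integrable_survival_adj: "integrable \<mu> (survival_adj t1)"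
proof -
  have "integrable \<mu> (\<lambda>y. LINT x|\<mu>. u t1 x y)" by (rule pair.integrable_snd[OF heat])
  then show ?thesis
    by (rule integrable_cong_AE_imp) (use survival_adj_AE in \<open>auto elim: eventually_mono\<close>)
qed

text \<open>
  \<open>\<psi> = exp(l t\<^sub>1) U\<^sub>t\<^sub>1\<^sup>* \<psi>\<close> and \<open>\<psi>\<close> is bounded, so \<open>\<psi>\<close> inherits integrability from \<open>U\<^sub>t\<^sub>1\<^sup>* 1\<close>.
\<close>

lemma \<psi>_le_survival_adj: obtains c where "0 < c" "\<And>y. \<psi> y \<le> c * survival_adj t1 y"
proof -
  interpret adj: ergodic_kernel_semigroup \<mu> "adj_kernel u" \<psi> \<phi> l \<gamma> L C0 t0 t1 by (rule adjoint)
  obtain d where d: "0 < d" "\<And>x. \<psi> x \<le> d" by (rule adj.\<phi>_bound) blast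
  have "AE y in \<mu>. norm (kernel_op \<mu> (adj_kernel u t1) \<psi> y) \<le> d * survival_adj t1 y"
    using adj.integrable_u_bounded[OF t1_pos meas_\<psi>, of d] d \<psi>_nonneg by (auto elim: eventually_mono)
  then have "AE y in \<mu>. \<psi> y \<le> (exp (l * t1) * d) * survival_adj t1 y"
    using adj_eigenfunction[OF t1_pos]
  proof eventually_elim
    fix y assume "norm (kernel_op \<mu> (adj_kernel u t1) \<psi> y) \<le> d * survival_adj t1 y"
      and "kernel_op \<mu> (adj_kernel u t1) \<psi> y = exp (- l * t1) * \<psi> y"
    then have "exp (- l * t1) * \<psi> y \<le> d * survival_adj t1 y" by simp
    then have "exp (l * t1) * (exp (- l * t1) * \<psi> y) \<le> exp (l * t1) * (d * survival_adj t1 y)"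
      by (intro mult_left_mono) auto
    then show "\<psi> y \<le> (exp (l * t1) * d) * survival_adj t1 y"
      by (simp add: mult.assoc[symmetric] exp_add[symmetric])
  qed
  then have "\<psi> y \<le> (exp (l * t1) * d) * survival_adj t1 y" for y
    by (rule everywhere) (intro closed_Collect_le continuous_intros \<psi>_cont survival_adj_cont)
  then show ?thesis using d(1) by (intro that[of "exp (l * t1) * d"]) auto
qed

lemma integrable_\<psi>: "integrable \<mu> \<psi>"
proof -
  obtain c where c: "0 < c" "\<And>y. \<psi> y \<le> c * survival_adj t1 y" by (rule \<psi>_le_survival_adj) blast
  have "integrable \<mu> (\<lambda>y. c * survival_adj t1 y)" using integrable_survival_adj by simp
  then show ?thesis
    by (rule Bochner_Integration.integrable_bound)
      (use c \<psi>_nonneg in \<open>auto intro: order_trans[OF _ abs_ge_self]\<close>)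
qed

lemma integral_\<psi>_pos: "0 < (LINT y|\<mu>. \<psi> y)"
proof (rule ccontr)
  assume "\<not> ?thesis"
  then have "(LINT y|\<mu>. \<psi> y) = 0" using Bochner_Integration.integral_nonneg[of \<mu> \<psi>] \<psi>_nonneg by (simp add: order.antisym)
  then have "AE y in \<mu>. \<psi> y = 0" using integral_nonneg_eq_0_iff_AE[OF integrable_\<psi>] \<psi>_nonneg by simp
  with \<psi>_pos have "AE y in \<mu>. False" by eventually_elim simp
  then show False using AE_ex by blast
qed

text \<open>
  \<open>C\<^sub>0\<close> times what is lost by using the convergence bound at time \<open>t - 2 t\<^sub>1\<close> and multiplying it by
  \<open>exp(l t\<^sub>1)\<close> on either side.
\<close>

definition error_const where "error_const = C0 * exp (2 * l * t1) * exp (2 * \<gamma> * t1)"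

lemma error_const_pos: "0 < error_const" unfolding error_const_def using C0_pos by simp

lemma estimate_commute:
  assumes "0 < t" and [measurable]: "a \<in> borel_measurable \<mu>" "b \<in> borel_measurable \<mu>"
  shows "(AE x in \<mu>. AE y in \<mu>. \<bar>e * u t x y - \<phi> x * \<psi> y / L\<bar> \<le> a x * b y) \<longleftrightarrow>
    (AE y in \<mu>. AE x in \<mu>. \<bar>e * u t x y - \<phi> x * \<psi> y / L\<bar> \<le> a x * b y)"
  using assms(1) by (intro pair.AE_commute) measurable

text \<open>
  The uniform error \<open>C\<^sub>0 exp(- \<gamma> t)\<close> is useless on a space of infinite measure. Writing
  \<open>U\<^sub>t = U\<^sub>t\<^sub>1 U\<^sub>r U\<^sub>t\<^sub>1\<close> with \<open>r = t - 2 t\<^sub>1 > 2 t\<^sub>0\<close> reproduces the rank-one kernel, because \<open>\<phi>\<close> and \<open>\<psi>\<close>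
  are eigenfunctions, and weights the error by \<open>U\<^sub>t\<^sub>1 1\<close> in \<open>x\<close> and by the integrable function
  \<open>U\<^sub>t\<^sub>1\<^sup>* 1\<close> in \<open>y\<close>.
\<close>

lemma kernel_estimate:
  assumes t: "4 * t1 < t"
  shows "AE x in \<mu>. AE y in \<mu>. \<bar>exp (l * t) * u t x y - \<phi> x * \<psi> y / L\<bar>
    \<le> error_const * exp (- \<gamma> * t) * survival t1 x * survival_adj t1 y"
proof -
  interpret adj: ergodic_kernel_semigroup \<mu> "adj_kernel u" \<psi> \<phi> l \<gamma> L C0 t0 t1 by (rule adjoint)
  \<comment> \<open>\<open>t > 4 t1\<close> leaves \<open>r > 2 t1 \<ge> 2 t0\<close>, where the convergence bound applies.\<close>
  define r where "r = t - 2 * t1"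
  have r: "2 * t0 < r" "0 < r" "0 < t1 + r" using t t1_ge t0_pos unfolding r_def by auto
  let ?e = "C0 * exp (- \<gamma> * r)"
  define a b where "a = survival t1" and "b = survival_adj t1"
  have [measurable]: "a \<in> borel_measurable \<mu>" "b \<in> borel_measurable \<mu>"
    unfolding a_def b_def using t1_pos by measurable
  have "AE x in \<mu>. AE y in \<mu>. \<bar>exp (l * r) * u r x y - \<phi> x * \<psi> y / L\<bar> \<le> 1 * ?e"
    using convergence[OF r(1)] by simp
  note H = compose_estimate[OF t1_pos r(2) _ _ _ this, of 1]
  have half: "AE x in \<mu>. AE y in \<mu>. \<bar>exp (l * (t1 + r)) * u (t1 + r) x y - \<phi> x * \<psi> y / L\<bar>
      \<le> 1 * (exp (l * t1) * ?e * a x)"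
    using H[simplified] eigenfunction[OF t1_pos] survival_AE[OF t1_pos, folded a_def]
  proof eventually_elim
    fix x assume A: "AE y in \<mu>. \<bar>exp (l * r) * u (t1 + r) x y - kernel_op \<mu> (u t1) \<phi> x * \<psi> y / L\<bar>
        \<le> kernel_op \<mu> (u t1) (\<lambda>_. 1) x * (C0 * exp (- (\<gamma> * r)))"
      and B: "kernel_op \<mu> (u t1) \<phi> x = exp (- l * t1) * \<phi> x"
      and C: "a x = (LINT y|\<mu>. u t1 x y)"
    from A show "AE y in \<mu>. \<bar>exp (l * (t1 + r)) * u (t1 + r) x y - \<phi> x * \<psi> y / L\<bar>
      \<le> 1 * (exp (l * t1) * ?e * a x)"
    proof eventually_elim
      fix y assume A: "\<bar>exp (l * r) * u (t1 + r) x y - kernel_op \<mu> (u t1) \<phi> x * \<psi> y / L\<bar>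
        \<le> kernel_op \<mu> (u t1) (\<lambda>_. 1) x * (C0 * exp (- (\<gamma> * r)))"
      have E: "exp (l * (t1 + r)) * u (t1 + r) x y - \<phi> x * \<psi> y / L
        = exp (l * t1) * (exp (l * r) * u (t1 + r) x y - exp (- l * t1) * \<phi> x * \<psi> y / L)"
        by (simp add: algebra_simps exp_add exp_minus)
      have "\<bar>exp (l * (t1 + r)) * u (t1 + r) x y - \<phi> x * \<psi> y / L\<bar>
        = exp (l * t1) * \<bar>exp (l * r) * u (t1 + r) x y - kernel_op \<mu> (u t1) \<phi> x * \<psi> y / L\<bar>"
        unfolding E B by (simp add: abs_mult)
      also have "\<dots> \<le> exp (l * t1) * (a x * ?e)"
        using A C by (intro mult_left_mono) (simp_all add: kernel_op_def)
      finally show "\<bar>exp (l * (t1 + r)) * u (t1 + r) x y - \<phi> x * \<psi> y / L\<bar>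
        \<le> 1 * (exp (l * t1) * ?e * a x)" by (simp add: mult_ac)
    qed
  qed
  have "AE y in \<mu>. AE x in \<mu>. \<bar>exp (l * (t1 + r)) * adj_kernel u (t1 + r) y x - \<psi> y * \<phi> x / L\<bar>
      \<le> 1 * (exp (l * t1) * ?e * a x)"
    using half estimate_commute[OF r(3), of "\<lambda>x. exp (l * t1) * ?e * a x" "\<lambda>_. 1" "exp (l * (t1 + r))"]
    by (simp add: adj_kernel_def mult.commute[of "\<psi> _" "\<phi> _"])
  note H2 = adj.compose_estimate[OF t1_pos r(3) _ _ _ this, of 1]
  have H2': "AE y in \<mu>. AE x in \<mu>. \<bar>exp (l * (t1 + r)) * adj_kernel u (t1 + (t1 + r)) y x - kernel_op \<mu> (adj_kernel u t1) \<psi> y * \<phi> x / L\<bar>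
        \<le> kernel_op \<mu> (adj_kernel u t1) (\<lambda>_. 1) y * (exp (l * t1) * (C0 * exp (- (\<gamma> * r))) * a x)"
    using H2 by simp
  have tt: "t1 + (t1 + r) = t" unfolding r_def by simp
  have "AE y in \<mu>. AE x in \<mu>. \<bar>exp (l * t) * u t x y - \<phi> x * \<psi> y / L\<bar>
      \<le> error_const * exp (- \<gamma> * t) * a x * b y"
    using H2' adj_eigenfunction[OF t1_pos] survival_adj_AE[folded b_def]
  proof eventually_elim
    fix y assume A: "AE x in \<mu>. \<bar>exp (l * (t1 + r)) * adj_kernel u (t1 + (t1 + r)) y x - kernel_op \<mu> (adj_kernel u t1) \<psi> y * \<phi> x / L\<bar>
        \<le> kernel_op \<mu> (adj_kernel u t1) (\<lambda>_. 1) y * (exp (l * t1) * (C0 * exp (- (\<gamma> * r))) * a x)"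
      and B: "kernel_op \<mu> (adj_kernel u t1) \<psi> y = exp (- l * t1) * \<psi> y"
      and C: "b y = (LINT x|\<mu>. u t1 x y)"
    from A show "AE x in \<mu>. \<bar>exp (l * t) * u t x y - \<phi> x * \<psi> y / L\<bar>
      \<le> error_const * exp (- \<gamma> * t) * a x * b y"
    proof eventually_elim
      fix x assume A: "\<bar>exp (l * (t1 + r)) * adj_kernel u (t1 + (t1 + r)) y x - kernel_op \<mu> (adj_kernel u t1) \<psi> y * \<phi> x / L\<bar>
        \<le> kernel_op \<mu> (adj_kernel u t1) (\<lambda>_. 1) y * (exp (l * t1) * (C0 * exp (- (\<gamma> * r))) * a x)"
      have E: "exp (l * t) * u t x y - \<phi> x * \<psi> y / L
        = exp (l * t1) * (exp (l * (t1 + r)) * u t x y - exp (- l * t1) * \<psi> y * \<phi> x / L)"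
      proof -
        have e: "exp (l * t) = exp (l * t1) * exp (l * (t1 + r))"
          unfolding tt[symmetric] by (simp only: distrib_left exp_add)
        have e': "\<phi> x * \<psi> y / L = exp (l * t1) * (exp (- l * t1) * \<psi> y * \<phi> x / L)"
          by (simp add: exp_minus)
        show ?thesis unfolding e e' by (simp only: right_diff_distrib mult.assoc)
      qed
      have "\<bar>exp (l * t) * u t x y - \<phi> x * \<psi> y / L\<bar>
        = exp (l * t1) * \<bar>exp (l * (t1 + r)) * adj_kernel u (t1 + (t1 + r)) y x - kernel_op \<mu> (adj_kernel u t1) \<psi> y * \<phi> x / L\<bar>"
        unfolding E B tt by (simp add: abs_mult adj_kernel_def)
      also have "\<dots> \<le> exp (l * t1) * (b y * (exp (l * t1) * (C0 * exp (- (\<gamma> * r))) * a x))"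
        using A C by (intro mult_left_mono) (simp_all add: kernel_op_def adj_kernel_def)
      also have "\<dots> = error_const * exp (- \<gamma> * t) * a x * b y"
      proof -
        have e: "exp (l * t1) * exp (l * t1) = exp (2 * l * t1)" "exp (- (\<gamma> * r)) = exp (2 * \<gamma> * t1) * exp (- \<gamma> * t)"
          by (simp_all add: exp_add[symmetric] r_def algebra_simps)
        show ?thesis unfolding error_const_def e(1)[symmetric] e(2) by (simp add: mult_ac)
      qed
      finally show "\<bar>exp (l * t) * u t x y - \<phi> x * \<psi> y / L\<bar>
        \<le> error_const * exp (- \<gamma> * t) * a x * b y" .
    qed
  qed
  then show ?thesis
    using estimate_commute[of t "\<lambda>x. error_const * exp (- \<gamma> * t) * a x" b "exp (l * t)"] t t1_pos
    by (simp add: a_def b_def)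
qed

section \<open>Estimates for the operators\<close>

lemma operator_estimate_AE:
  fixes f :: "'a \<Rightarrow> 'b::{banach,second_countable_topology}"
  assumes t: "4 * t1 < t" and [measurable]: "f \<in> borel_measurable \<mu>"
    and f: "integrable \<mu> (\<lambda>y. survival_adj t1 y * norm (f y))"
  shows "AE x in \<mu>. integrable \<mu> (\<lambda>y. u t x y *\<^sub>R f y) \<and>
    norm (exp (l * t) *\<^sub>R kernel_op \<mu> (u t) f x - (\<phi> x / L) *\<^sub>R (LINT y|\<mu>. \<psi> y *\<^sub>R f y))
      \<le> error_const * exp (- \<gamma> * t) * survival t1 x * (LINT y|\<mu>. survival_adj t1 y * norm (f y))"
proof -
  have t_pos: "0 < t" using t t1_pos by simp
  obtain c where c: "0 < c" "\<And>y. \<psi> y \<le> c * survival_adj t1 y" by (rule \<psi>_le_survival_adj) blast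
  have i\<psi>: "integrable \<mu> (\<lambda>y. \<psi> y *\<^sub>R f y)"
  proof (rule Bochner_Integration.integrable_bound)
    show "integrable \<mu> (\<lambda>y. c * (survival_adj t1 y * norm (f y)))" using f by simp
    show "AE y in \<mu>. norm (\<psi> y *\<^sub>R f y) \<le> norm (c * (survival_adj t1 y * norm (f y)))"
      using c survival_adj_nonneg \<psi>_nonneg
      by (intro AE_I2) (simp add: abs_mult mult.assoc[symmetric] mult_right_mono)
  qed measurable
  show ?thesis using kernel_estimate[OF t] AE_space
  proof eventually_elim
    fix x assume K: "AE y in \<mu>. \<bar>exp (l * t) * u t x y - \<phi> x * \<psi> y / L\<bar>
        \<le> error_const * exp (- \<gamma> * t) * survival t1 x * survival_adj t1 y" and x: "x \<in> space \<mu>"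
    let ?e = "error_const * exp (- \<gamma> * t) * survival t1 x"
    let ?d = "\<lambda>y. (exp (l * t) * u t x y - \<phi> x * \<psi> y / L) *\<^sub>R f y"
    have [measurable]: "?d \<in> borel_measurable \<mu>" using x t_pos by measurable
    have ib: "integrable \<mu> (\<lambda>y. ?e * (survival_adj t1 y * norm (f y)))" using f by simp
    have le: "AE y in \<mu>. norm (?d y) \<le> ?e * (survival_adj t1 y * norm (f y))"
      using K by eventually_elim (simp add: mult.assoc[symmetric] mult_right_mono)
    have id: "integrable \<mu> ?d"
      by (rule Bochner_Integration.integrable_bound[OF ib])
        (use le in \<open>auto elim!: eventually_mono intro: order_trans[OF _ abs_ge_self]\<close>)
    have "integrable \<mu> (\<lambda>y. exp (- l * t) *\<^sub>R (?d y + (\<phi> x / L) *\<^sub>R (\<psi> y *\<^sub>R f y)))"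
      using id i\<psi> by (intro integrable_scaleR_right Bochner_Integration.integrable_add) auto
    moreover have "exp (- l * t) *\<^sub>R (?d y + (\<phi> x / L) *\<^sub>R (\<psi> y *\<^sub>R f y)) = u t x y *\<^sub>R f y" for y
      by (simp add: scaleR_add_left[symmetric] exp_minus)
    ultimately have iu: "integrable \<mu> (\<lambda>y. u t x y *\<^sub>R f y)" by simp
    have "exp (l * t) *\<^sub>R kernel_op \<mu> (u t) f x - (\<phi> x / L) *\<^sub>R (LINT y|\<mu>. \<psi> y *\<^sub>R f y)
      = (LINT y|\<mu>. exp (l * t) *\<^sub>R (u t x y *\<^sub>R f y) - (\<phi> x / L) *\<^sub>R (\<psi> y *\<^sub>R f y))"
      unfolding kernel_op_def using iu i\<psi> by (subst Bochner_Integration.integral_diff) (simp_all del: scaleR_scaleR)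
    also have "\<dots> = (LINT y|\<mu>. ?d y)" by (intro Bochner_Integration.integral_cong) (simp_all add: scaleR_diff_left)
    finally have E: "exp (l * t) *\<^sub>R kernel_op \<mu> (u t) f x - (\<phi> x / L) *\<^sub>R (LINT y|\<mu>. \<psi> y *\<^sub>R f y) = (LINT y|\<mu>. ?d y)" .
    have "norm (LINT y|\<mu>. ?d y) \<le> (LINT y|\<mu>. norm (?d y))" by (rule integral_norm_bound)
    also have "\<dots> \<le> (LINT y|\<mu>. ?e * (survival_adj t1 y * norm (f y)))"
      by (rule integral_mono_AE[OF integrable_norm[OF id] ib le])
    finally have "norm (LINT y|\<mu>. ?d y) \<le> ?e * (LINT y|\<mu>. survival_adj t1 y * norm (f y))" by simp
    with E iu show "integrable \<mu> (\<lambda>y. u t x y *\<^sub>R f y) \<and>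
      norm (exp (l * t) *\<^sub>R kernel_op \<mu> (u t) f x - (\<phi> x / L) *\<^sub>R (LINT y|\<mu>. \<psi> y *\<^sub>R f y))
      \<le> ?e * (LINT y|\<mu>. survival_adj t1 y * norm (f y))" by simp
  qed
qed

lemma kernel_op_bounded:
  fixes f :: "'a \<Rightarrow> 'b::{banach,second_countable_topology}"
  assumes t: "4 * t1 < t" and f: "f \<in> borel_measurable \<mu>"
    "integrable \<mu> (\<lambda>y. survival_adj t1 y * norm (f y))"
  shows "\<exists>c. AE x in \<mu>. norm (kernel_op \<mu> (u t) f x) \<le> c"
proof -
  obtain p where p: "0 < p" "\<And>x. \<phi> x \<le> p" by (rule \<phi>_bound) blast
  obtain a where a: "0 < a" "\<And>x. survival t1 x \<le> a" by (rule survival_bound[OF t1_pos]) blast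
  let ?P = "LINT y|\<mu>. \<psi> y *\<^sub>R f y" and ?B = "LINT y|\<mu>. survival_adj t1 y * norm (f y)"
  have B: "0 \<le> ?B" using survival_adj_nonneg by (intro Bochner_Integration.integral_nonneg) auto
  show ?thesis
  proof (rule exI, use operator_estimate_AE[OF t f] in eventually_elim)
    fix x assume A: "integrable \<mu> (\<lambda>y. u t x y *\<^sub>R f y) \<and> norm (exp (l * t) *\<^sub>R kernel_op \<mu> (u t) f x - (\<phi> x / L) *\<^sub>R ?P)
      \<le> error_const * exp (- \<gamma> * t) * survival t1 x * ?B"
    have "exp (l * t) * norm (kernel_op \<mu> (u t) f x) = norm (exp (l * t) *\<^sub>R kernel_op \<mu> (u t) f x)" by simp
    also have "\<dots> \<le> norm ((\<phi> x / L) *\<^sub>R ?P) + norm (exp (l * t) *\<^sub>R kernel_op \<mu> (u t) f x - (\<phi> x / L) *\<^sub>R ?P)"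
      by (rule norm_triangle_sub)
    also have "\<dots> \<le> p / L * norm ?P + error_const * exp (- \<gamma> * t) * a * ?B"
    proof (rule add_mono)
      have "\<phi> x / L * norm ?P \<le> p / L * norm ?P"
        using p L_pos by (intro mult_right_mono divide_right_mono) auto
      then show "norm ((\<phi> x / L) *\<^sub>R ?P) \<le> p / L * norm ?P" using \<phi>_nonneg[of x] L_pos by simp
      have "error_const * exp (- \<gamma> * t) * survival t1 x * ?B \<le> error_const * exp (- \<gamma> * t) * a * ?B"
        using a(2) error_const_pos B by (intro mult_right_mono mult_left_mono) auto
      then show "norm (exp (l * t) *\<^sub>R kernel_op \<mu> (u t) f x - (\<phi> x / L) *\<^sub>R ?P) \<le> error_const * exp (- \<gamma> * t) * a * ?B"
        using A by linarith
    qed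
    finally show "norm (kernel_op \<mu> (u t) f x) \<le> (p / L * norm ?P + error_const * exp (- \<gamma> * t) * a * ?B) / exp (l * t)"
      by (simp add: field_simps)
  qed
qed

text \<open>
  The Feller property provides continuous versions of \<open>U\<^sub>t f\<close> for bounded \<open>f\<close> only. If \<open>f\<close> is merely
  integrable against \<open>U\<^sub>t\<^sub>1\<^sup>* 1\<close>, then \<open>U\<^sub>r f\<close> with \<open>r = t - t\<^sub>1\<close> is bounded by the kernel estimate, and
  \<open>U\<^sub>t f = U\<^sub>t\<^sub>1 (U\<^sub>r f)\<close> almost everywhere by Fubini's theorem.
\<close>

lemma Cb_op_version_weighted:
  fixes f :: "'a \<Rightarrow> complex"
  assumes t: "5 * t1 < t" and [measurable]: "f \<in> borel_measurable \<mu>"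
    and f: "integrable \<mu> (\<lambda>y. survival_adj t1 y * norm (f y))"
  shows "is_Cb_version \<mu> (kernel_op \<mu> (u t) f) (Cb_op \<mu> (u t) f)"
proof -
  define r where "r = t - t1"
  have r: "4 * t1 < r" "0 < r" and tr: "t = t1 + r" using t t1_pos unfolding r_def by auto
  define g where "g = kernel_op \<mu> (u r) f"
  have g_meas[measurable]: "g \<in> borel_measurable \<mu>" unfolding g_def by (rule meas_kernel_op[OF r(2)]) simp
  have "\<exists>c. AE x in \<mu>. norm (g x) \<le> c" unfolding g_def by (rule kernel_op_bounded[OF r(1) _ f]) simp
  then have g: "g \<in> Lp_space \<mu> \<infinity>" using Linf_I[OF g_meas] by blast
  have "AE x in \<mu>. kernel_op \<mu> (u t) f x = kernel_op \<mu> (u t1) g x"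
  proof -
    have nf: "(\<lambda>y. norm (f y)) \<in> borel_measurable \<mu>" "integrable \<mu> (\<lambda>y. survival_adj t1 y * norm (norm (f y)))"
      using f by auto
    \<comment> \<open>\<open>U\<^sub>r \<bar>f\<bar>\<close> is bounded as well, which is what makes Fubini's theorem applicable.\<close>
    define h where "h = kernel_op \<mu> (u r) (\<lambda>y. norm (f y))"
    have h_meas[measurable]: "h \<in> borel_measurable \<mu>" unfolding h_def by (rule meas_kernel_op[OF r(2)]) simp
    obtain c where c: "AE z in \<mu>. norm (h z) \<le> c"
      using kernel_op_bounded[OF r(1) nf] unfolding h_def by auto
    have "AE x in \<mu>. integrable \<mu> (\<lambda>z. u t1 x z * h z)"
      using integrable_u_bounded[OF t1_pos h_meas c] by (auto elim: eventually_mono)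
    from composition[OF t1_pos r(2)] this nonneg[OF t1_pos] AE_space show ?thesis
    proof eventually_elim
      fix x assume comp: "AE y in \<mu>. integrable \<mu> (\<lambda>z. u t1 x z * u r z y) \<and> u (t1 + r) x y = (LINT z|\<mu>. u t1 x z * u r z y)"
        and ih: "integrable \<mu> (\<lambda>z. u t1 x z * h z)" and n: "AE z in \<mu>. 0 \<le> u t1 x z" and x: "x \<in> space \<mu>"
      let ?H = "\<lambda>z y. (u t1 x z * u r z y) *\<^sub>R f y"
      have [measurable]: "case_prod ?H \<in> borel_measurable (\<mu> \<Otimes>\<^sub>M \<mu>)" using x r(2) t1_pos by measurable
      have fin: "AE z in \<mu>. integrable \<mu> (\<lambda>y. u r z y *\<^sub>R f y)"
        using operator_estimate_AE[OF r(1) _ f] by (auto elim: eventually_mono)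
      have H: "integrable (\<mu> \<Otimes>\<^sub>M \<mu>) (case_prod ?H)"
      proof (rule pair.Fubini_integrable)
        have "AE z in \<mu>. u t1 x z * h z = (LINT y|\<mu>. norm (case_prod ?H (z, y)))"
          using n nonneg[OF r(2)]
        proof eventually_elim
          fix z assume n: "0 \<le> u t1 x z" and n': "AE y in \<mu>. 0 \<le> u r z y"
          have "(LINT y|\<mu>. norm (case_prod ?H (z, y))) = (LINT y|\<mu>. u t1 x z * (\<bar>u r z y\<bar> * norm (f y)))"
            using n by (intro Bochner_Integration.integral_cong) (auto simp: abs_mult)
          also have "\<dots> = u t1 x z * (LINT y|\<mu>. \<bar>u r z y\<bar> * norm (f y))" by simp
          also have "(LINT y|\<mu>. \<bar>u r z y\<bar> * norm (f y)) = h z"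
            unfolding h_def kernel_op_def
            using n' space_UNIV r(2) by (intro integral_cong_AE) (auto elim: eventually_mono)
          finally show "u t1 x z * h z = (LINT y|\<mu>. norm (case_prod ?H (z, y)))" by simp
        qed
        then show "integrable \<mu> (\<lambda>z. LINT y|\<mu>. norm (case_prod ?H (z, y)))"
          by (rule integrable_cong_AE_imp[OF ih, rotated]) measurable
        show "AE z in \<mu>. integrable \<mu> (\<lambda>y. case_prod ?H (z, y))"
          using fin by eventually_elim (simp flip: scaleR_scaleR)
      qed measurable
      have "kernel_op \<mu> (u t) f x = (LINT y|\<mu>. (LINT z|\<mu>. ?H z y))"
        unfolding kernel_op_def tr
      proof (rule integral_cong_AE)
        show "AE y in \<mu>. u (t1 + r) x y *\<^sub>R f y = (LINT z|\<mu>. ?H z y)"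
          using comp by eventually_elim simp
        show "(\<lambda>y. u (t1 + r) x y *\<^sub>R f y) \<in> borel_measurable \<mu>"
          using x t1_pos r(2) by (intro borel_measurable_scaleR meas_u) auto
        show "(\<lambda>y. LINT z|\<mu>. ?H z y) \<in> borel_measurable \<mu>" by measurable
      qed
      also have "\<dots> = (LINT z|\<mu>. (LINT y|\<mu>. ?H z y))" by (rule pair.Fubini_integral[OF H])
      also have "\<dots> = kernel_op \<mu> (u t1) g x"
        unfolding kernel_op_def g_def by (simp flip: scaleR_scaleR)
      finally show "kernel_op \<mu> (u t) f x = kernel_op \<mu> (u t1) g x" .
    qed
  qed
  moreover have "is_Cb_version \<mu> (kernel_op \<mu> (u t1) g) (Cb_op \<mu> (u t1) g)"
    by (rule Cb_op_Linf[OF t1_pos g])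
  ultimately have "is_Cb_version \<mu> (kernel_op \<mu> (u t) f) (Cb_op \<mu> (u t1) g)"
    unfolding is_Cb_version_def by (auto elim: eventually_elim2)
  then show ?thesis by (rule Cb_op_version)
qed

lemma operator_estimate:
  fixes f :: "'a \<Rightarrow> complex"
  assumes t: "5 * t1 < t" and f: "f \<in> borel_measurable \<mu>" "integrable \<mu> (\<lambda>y. survival_adj t1 y * norm (f y))"
  shows "norm (exp (l * t) *\<^sub>R Cb_op \<mu> (u t) f x - (\<phi> x / L) *\<^sub>R (LINT y|\<mu>. \<psi> y *\<^sub>R f y))
      \<le> error_const * exp (- \<gamma> * t) * survival t1 x * (LINT y|\<mu>. survival_adj t1 y * norm (f y))"
proof (rule everywhere)
  have v: "continuous_on UNIV (Cb_op \<mu> (u t) f)" "AE x in \<mu>. Cb_op \<mu> (u t) f x = kernel_op \<mu> (u t) f x"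
    using Cb_op_version_weighted[OF t f] unfolding is_Cb_version_def by auto
  have "4 * t1 < t" using t t1_pos by simp
  from v(2) operator_estimate_AE[OF this f]
  show "AE x in \<mu>. norm (exp (l * t) *\<^sub>R Cb_op \<mu> (u t) f x - (\<phi> x / L) *\<^sub>R (LINT y|\<mu>. \<psi> y *\<^sub>R f y))
      \<le> error_const * exp (- \<gamma> * t) * survival t1 x * (LINT y|\<mu>. survival_adj t1 y * norm (f y))"
    by eventually_elim simp
  show "closed {x. norm (exp (l * t) *\<^sub>R Cb_op \<mu> (u t) f x - (\<phi> x / L) *\<^sub>R (LINT y|\<mu>. \<psi> y *\<^sub>R f y))
      \<le> error_const * exp (- \<gamma> * t) * survival t1 x * (LINT y|\<mu>. survival_adj t1 y * norm (f y))}"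
    using L_pos by (intro closed_Collect_le continuous_intros v(1) \<phi>_cont survival_cont[OF t1_pos]) auto
qed

text \<open>
  The denominator of the ratio: with \<open>\<phi> \<le> c\<close>, positivity gives \<open>\<phi> = exp(l t) U\<^sub>t \<phi> \<le> c exp(l t) U\<^sub>t 1\<close>.
  This holds at all times and all points, whereas the kernel estimate bounds \<open>U\<^sub>t 1\<close> from below only at
  times that depend on the point.
\<close>

lemma survival_lower_bound:
  obtains c where "0 < c" "\<And>t x. 0 < t \<Longrightarrow> \<phi> x \<le> c * (exp (l * t) * survival t x)"
proof -
  obtain c where c: "0 < c" "\<And>x. \<phi> x \<le> c" by (rule \<phi>_bound) blast
  have "\<phi> x \<le> c * (exp (l * t) * survival t x)" if t: "0 < t" for t x
  proof (rule everywhere)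
    have "AE x in \<mu>. norm (kernel_op \<mu> (u t) \<phi> x) \<le> c * survival t x"
      using integrable_u_bounded[OF t meas_\<phi>, of c] c \<phi>_nonneg by (auto elim: eventually_mono)
    then show "AE x in \<mu>. \<phi> x \<le> c * (exp (l * t) * survival t x)"
      using eigenfunction[OF t]
    proof eventually_elim
      fix x assume "norm (kernel_op \<mu> (u t) \<phi> x) \<le> c * survival t x" "kernel_op \<mu> (u t) \<phi> x = exp (- l * t) * \<phi> x"
      then have "exp (- l * t) * \<phi> x \<le> c * survival t x" by simp
      then have "exp (l * t) * (exp (- l * t) * \<phi> x) \<le> exp (l * t) * (c * survival t x)"
        by (intro mult_left_mono) auto
      moreover have "exp (l * t) * (exp (- l * t) * \<phi> x) = \<phi> x" by (simp add: exp_minus)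
      ultimately show "\<phi> x \<le> c * (exp (l * t) * survival t x)"
        by (simp only: mult.left_commute)
    qed
    show "closed {x. \<phi> x \<le> c * (exp (l * t) * survival t x)}"
      by (intro closed_Collect_le continuous_intros \<phi>_cont survival_cont[OF t])
  qed
  with c(1) show ?thesis by (intro that)
qed

section \<open>Convergence of the normalized semigroup\<close>

abbreviation qsd :: "'a measure" where "qsd \<equiv> normalized_measure \<mu> \<psi>"

lemma integral_qsd:
  fixes f :: "'a \<Rightarrow> 'b::{banach,second_countable_topology}"
  assumes "f \<in> borel_measurable \<mu>"
  shows "(LINT y|qsd. f y) = (LINT y|\<mu>. \<psi> y *\<^sub>R f y) /\<^sub>R (LINT y|\<mu>. \<psi> y)"
proof -
  let ?I = "LINT y|\<mu>. \<psi> y"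
  have "(LINT y|qsd. f y) = (LINT y|\<mu>. (\<psi> y / ?I) *\<^sub>R f y)"
    unfolding normalized_measure_def
    using assms \<psi>_nonneg integral_\<psi>_pos by (intro integral_density) (auto intro!: divide_nonneg_pos)
  also have "\<dots> = (LINT y|\<mu>. inverse ?I *\<^sub>R (\<psi> y *\<^sub>R f y))"
    by (simp add: divide_inverse mult.commute)
  also have "\<dots> = (LINT y|\<mu>. \<psi> y *\<^sub>R f y) /\<^sub>R ?I" by (rule integral_scaleR_right)
  finally show ?thesis .
qed

text \<open>
  With \<open>m\<close> the normalized measure, \<open>exp(l t) (U\<^sub>t f - m(f) U\<^sub>t 1)\<close> is a difference of two error terms,
  because the rank-one contributions \<open>\<phi> \<integral> \<psi> f / L\<close> and \<open>m(f) \<phi> \<integral> \<psi> / L\<close> cancel. Division by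
  \<open>exp(l t) U\<^sub>t 1 \<ge> \<phi> / c\<close> gives the claim. The constant is claimed for all larger values as well, so
  that the bounds for the semigroup and its adjoint can share one.
\<close>

lemma ratio_estimate:
  fixes p :: ennreal
  assumes p: "1 \<le> p"
  shows "\<exists>C0>0. \<forall>C\<ge>C0. \<forall>f::'a \<Rightarrow> complex. f \<in> Lp_space \<mu> p \<longrightarrow> Lp_norm \<mu> p f \<le> 1 \<longrightarrow>
    (\<forall>t>5 * t1. \<forall>x. 0 < \<phi> x \<longrightarrow>
      norm (Cb_op \<mu> (u t) f x / Cb_op \<mu> (u t) (\<lambda>_. 1) x - (LINT y|qsd. f y))
        \<le> C * exp (- \<gamma> * t) * (survival t1 x / \<phi> x))"
proof -
  obtain K where K: "0 < K" "\<And>f::'a \<Rightarrow> complex. f \<in> Lp_space \<mu> p \<Longrightarrow> Lp_norm \<mu> p f \<le> 1 \<Longrightarrow>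
    integrable \<mu> (\<lambda>x. survival_adj t1 x * norm (f x)) \<and> (LINT x|\<mu>. survival_adj t1 x * norm (f x)) \<le> K"
  proof -
    obtain c where "0 < c" "\<And>y. survival_adj t1 y \<le> c" by (rule survival_adj_bound) blast
    from weighted_integral_bound_Lp[OF integrable_survival_adj survival_adj_nonneg this(2) p, where 'b = complex] that
    show ?thesis by blast
  qed
  obtain c1 where c1: "0 < c1" "\<And>y. \<psi> y \<le> c1 * survival_adj t1 y" by (rule \<psi>_le_survival_adj) blast
  obtain c2 where c2: "0 < c2" "\<And>t x. 0 < t \<Longrightarrow> \<phi> x \<le> c2 * (exp (l * t) * survival t x)"
    by (rule survival_lower_bound) blast
  define I where "I = (LINT y|\<mu>. \<psi> y)"
  define J where "J = (LINT y|\<mu>. survival_adj t1 y)"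
  have I: "0 < I" unfolding I_def by (rule integral_\<psi>_pos)
  have J: "0 \<le> J" unfolding J_def using survival_adj_nonneg by (intro Bochner_Integration.integral_nonneg) auto
  define K' where "K' = c2 * error_const * (K + J * (c1 * K / I))"
  have K': "0 < K'" unfolding K'_def using c2(1) error_const_pos K(1) J c1(1) I by (intro mult_pos_pos add_pos_nonneg) auto
  have "norm (Cb_op \<mu> (u t) f x / Cb_op \<mu> (u t) (\<lambda>_. 1) x - (LINT y|qsd. f y))
        \<le> C * exp (- \<gamma> * t) * (survival t1 x / \<phi> x)"
    if C: "K' \<le> C" and f: "f \<in> Lp_space \<mu> p" "Lp_norm \<mu> p f \<le> 1" and t: "5 * t1 < t" and x: "0 < \<phi> x"
    for C t x and f :: "'a \<Rightarrow> complex"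
  proof -
    have [measurable]: "f \<in> borel_measurable \<mu>" using f(1) unfolding Lp_space_def by simp
    have t_pos: "0 < t" using t t1_pos by simp
    have fint: "integrable \<mu> (\<lambda>y. survival_adj t1 y * norm (f y))" and Kf: "(LINT y|\<mu>. survival_adj t1 y * norm (f y)) \<le> K"
      using K(2)[OF f] by auto
    let ?P = "LINT y|\<mu>. \<psi> y *\<^sub>R f y"
    define m where "m = (LINT y|qsd. f y)"
    have m: "m = ?P /\<^sub>R I" unfolding m_def I_def by (rule integral_qsd) simp
    have m_le: "norm m \<le> c1 * K / I"
    proof -
      have le: "norm (\<psi> y *\<^sub>R f y) \<le> c1 * (survival_adj t1 y * norm (f y))" for y
        using c1(2)[of y] \<psi>_nonneg[of y] by (simp add: mult.assoc[symmetric] mult_right_mono)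
      have int: "integrable \<mu> (\<lambda>y. c1 * (survival_adj t1 y * norm (f y)))" using fint by simp
      have "integrable \<mu> (\<lambda>y. \<psi> y *\<^sub>R f y)"
        by (rule Bochner_Integration.integrable_bound[OF int])
          (use le in \<open>auto intro: order_trans[OF _ abs_ge_self]\<close>)
      then have "(LINT y|\<mu>. norm (\<psi> y *\<^sub>R f y)) \<le> (LINT y|\<mu>. c1 * (survival_adj t1 y * norm (f y)))"
        by (intro integral_mono integrable_norm int le)
      then have "norm ?P \<le> (LINT y|\<mu>. c1 * (survival_adj t1 y * norm (f y)))"
        by (rule order_trans[OF integral_norm_bound])
      also have "\<dots> \<le> c1 * K" using Kf c1(1) by simp
      finally show ?thesis unfolding m using I by (simp add: divide_simps mult.commute)
    qed
    let ?s = "survival t x" and ?e = "error_const * exp (- \<gamma> * t) * survival t1 x"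
    have e: "0 \<le> ?e" using error_const_pos survival_nonneg[OF t1_pos] by simp
    have s: "0 < ?s"
    proof -
      have "0 < c2 * (exp (l * t) * ?s)" using c2(2)[OF t_pos, of x] x by linarith
      then show ?thesis using c2(1) by (simp add: zero_less_mult_iff)
    qed
    let ?F = "exp (l * t) *\<^sub>R Cb_op \<mu> (u t) f x - (\<phi> x / L) *\<^sub>R ?P"
    let ?G = "exp (l * t) * ?s - \<phi> x / L * I"
    have F: "norm ?F \<le> ?e * K"
      using operator_estimate[OF t _ fint, of x] mult_left_mono[OF Kf e] by simp
    have G: "\<bar>?G\<bar> \<le> ?e * J"
    proof -
      have "norm (exp (l * t) *\<^sub>R complex_of_real ?s - (\<phi> x / L) *\<^sub>R (LINT y|\<mu>. \<psi> y *\<^sub>R (1::complex))) \<le> ?e * J"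
        using operator_estimate[OF t, of "\<lambda>_. 1" x] integrable_survival_adj
        unfolding survival_complex[OF t_pos] J_def by simp
      moreover have "exp (l * t) *\<^sub>R complex_of_real ?s - (\<phi> x / L) *\<^sub>R (LINT y|\<mu>. \<psi> y *\<^sub>R (1::complex)) = complex_of_real ?G"
        unfolding I_def by (simp add: scaleR_conv_of_real)
      ultimately show ?thesis by (simp only: norm_of_real)
    qed
    have eq: "exp (l * t) *\<^sub>R (Cb_op \<mu> (u t) f x - ?s *\<^sub>R m) = ?F - ?G *\<^sub>R m"
    proof -
      have "?P = I *\<^sub>R m" using m I by simp
      then show ?thesis by (simp add: scaleR_diff_left scaleR_diff_right)
    qed
    have "exp (l * t) * norm (Cb_op \<mu> (u t) f x - ?s *\<^sub>R m) = norm (?F - ?G *\<^sub>R m)"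
      unfolding eq[symmetric] by simp
    also have "\<dots> \<le> norm ?F + norm (?G *\<^sub>R m)" by (rule norm_triangle_ineq4)
    also have "\<dots> \<le> ?e * K + ?e * J * (c1 * K / I)"
    proof (rule add_mono[OF F])
      show "norm (?G *\<^sub>R m) \<le> ?e * J * (c1 * K / I)"
        unfolding norm_scaleR using G m_le e J by (intro mult_mono) auto
    qed
    finally have A: "exp (l * t) * norm (Cb_op \<mu> (u t) f x - ?s *\<^sub>R m) \<le> ?e * (K + J * (c1 * K / I))"
      by (simp add: distrib_left mult.assoc)
    have "norm (Cb_op \<mu> (u t) f x / complex_of_real ?s - m) = norm (Cb_op \<mu> (u t) f x - ?s *\<^sub>R m) / ?s"
    proof -
      have "Cb_op \<mu> (u t) f x / complex_of_real ?s - m = (Cb_op \<mu> (u t) f x - ?s *\<^sub>R m) / complex_of_real ?s"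
        using s by (simp add: diff_divide_distrib scaleR_conv_of_real)
      then show ?thesis using s by (simp add: norm_divide)
    qed
    also have "\<dots> = (exp (l * t) * norm (Cb_op \<mu> (u t) f x - ?s *\<^sub>R m)) / (exp (l * t) * ?s)" by simp
    also have "\<dots> \<le> (?e * (K + J * (c1 * K / I))) / (exp (l * t) * ?s)"
      using A s by (intro divide_right_mono) auto
    also have "\<dots> \<le> (?e * (K + J * (c1 * K / I))) / (\<phi> x / c2)"
    proof (rule divide_left_mono)
      show "\<phi> x / c2 \<le> exp (l * t) * ?s" using c2(2)[OF t_pos, of x] c2(1) by (simp add: divide_simps mult.commute)
      show "0 \<le> ?e * (K + J * (c1 * K / I))" using e K(1) J c1(1) I by simp
      show "0 < exp (l * t) * ?s * (\<phi> x / c2)" using s x c2(1) by simp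
    qed
    also have "\<dots> = K' * (exp (- \<gamma> * t) * (survival t1 x / \<phi> x))"
      unfolding K'_def by (simp add: field_simps)
    also have "\<dots> \<le> C * (exp (- \<gamma> * t) * (survival t1 x / \<phi> x))"
      using C x survival_nonneg[OF t1_pos] by (intro mult_right_mono) auto
    finally show ?thesis unfolding survival_complex[OF t_pos] m_def by (simp add: mult.assoc)
  qed
  then show ?thesis using K' by (intro exI[of _ K'] conjI) blast+
qed

lemma ratio_estimate_compact:
  fixes p :: ennreal
  assumes p: "1 \<le> p" and K: "compact K" "K \<subseteq> {x. 0 < \<phi> x}"
  shows "\<exists>C0>0. \<forall>C\<ge>C0. \<forall>t>5 * t1.
    (SUP x\<in>K. SUP f\<in>{f::'a \<Rightarrow> complex. f \<in> Lp_space \<mu> p \<and> Lp_norm \<mu> p f \<le> 1}.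
      ereal (norm (Cb_op \<mu> (u t) f x / Cb_op \<mu> (u t) (\<lambda>_. 1) x - (LINT y|qsd. f y))))
    \<le> ereal (C * exp (- \<gamma> * t))"
proof -
  obtain C1 where C1: "0 < C1" "\<And>f t x. (f::'a \<Rightarrow> complex) \<in> Lp_space \<mu> p \<Longrightarrow> Lp_norm \<mu> p f \<le> 1 \<Longrightarrow> 5 * t1 < t \<Longrightarrow> 0 < \<phi> x \<Longrightarrow>
      norm (Cb_op \<mu> (u t) f x / Cb_op \<mu> (u t) (\<lambda>_. 1) x - (LINT y|qsd. f y))
        \<le> C1 * exp (- \<gamma> * t) * (survival t1 x / \<phi> x)"
    using ratio_estimate[OF p] by blast
  obtain a where a: "0 < a" "\<And>x. survival t1 x \<le> a" by (rule survival_bound[OF t1_pos]) blast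
  obtain d where d: "0 < d" "\<And>x. x \<in> K \<Longrightarrow> d \<le> \<phi> x"
  proof (cases "K = {}")
    case True
    then show ?thesis using that[of 1] by simp
  next
    case False
    have "continuous_on K \<phi>" using \<phi>_cont continuous_on_subset by blast
    from continuous_attains_inf[OF K(1) False this] obtain z where "z \<in> K" "\<forall>y\<in>K. \<phi> z \<le> \<phi> y" by blast
    then show ?thesis using that[of "\<phi> z"] K(2) by blast
  qed
  have main: "norm (Cb_op \<mu> (u t) f x / Cb_op \<mu> (u t) (\<lambda>_. 1) x - (LINT y|qsd. f y)) \<le> C * exp (- \<gamma> * t)"
    if C: "C1 * (a / d) \<le> C" and t: "5 * t1 < t" and x: "x \<in> K"
      and f: "f \<in> Lp_space \<mu> p" "Lp_norm \<mu> p f \<le> 1" for C t x and f :: "'a \<Rightarrow> complex"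
  proof -
    have "norm (Cb_op \<mu> (u t) f x / Cb_op \<mu> (u t) (\<lambda>_. 1) x - (LINT y|qsd. f y))
      \<le> C1 * exp (- \<gamma> * t) * (survival t1 x / \<phi> x)"
      using C1(2)[OF f t, of x] K(2) x by auto
    also have "\<dots> \<le> C1 * exp (- \<gamma> * t) * (a / d)"
      using C1(1) a d x survival_nonneg[OF t1_pos] by (intro mult_left_mono frac_le) auto
    also have "\<dots> = C1 * (a / d) * exp (- \<gamma> * t)" by simp
    also have "\<dots> \<le> C * exp (- \<gamma> * t)" using C by (intro mult_right_mono) auto
    finally show ?thesis .
  qed
  show ?thesis
  proof (intro exI[of _ "C1 * (a / d)"] conjI allI impI SUP_least)
    show "0 < C1 * (a / d)" using C1(1) a(1) d(1) by simp
  qed (use main in auto)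
qed

section \<open>Quasi-stationary measures\<close>

text \<open>
  \<open>\<integral> \<psi> U\<^sub>t f = \<integral> (U\<^sub>t\<^sup>* \<psi>) f\<close> by Fubini's theorem, and \<open>\<psi>\<close> is an eigenfunction of the adjoint.
\<close>

lemma qsd_integral_invariant:
  fixes f :: "'a \<Rightarrow> complex"
  assumes t: "0 < t" and f: "f \<in> Lp_space \<mu> \<infinity>"
  shows "(LINT x|qsd. Cb_op \<mu> (u t) f x) = exp (- l * t) *\<^sub>R (LINT x|qsd. f x)"
proof -
  obtain c where [measurable]: "f \<in> borel_measurable \<mu>" and c: "0 \<le> c" "AE x in \<mu>. norm (f x) \<le> c"
    using Linf_D[OF f] by blast
  have v: "continuous_on UNIV (Cb_op \<mu> (u t) f)" "AE x in \<mu>. Cb_op \<mu> (u t) f x = kernel_op \<mu> (u t) f x"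
    using Cb_op_Linf[OF t f] unfolding is_Cb_version_def by auto
  note [measurable] = meas_cont[OF v(1)] meas_kernel_op[OF t, of f]
  let ?H = "\<lambda>x y. (\<psi> x * u t x y) *\<^sub>R f y"
  have [measurable]: "case_prod ?H \<in> borel_measurable (\<mu> \<Otimes>\<^sub>M \<mu>)" using t by measurable
  have nf: "AE x in \<mu>. norm (norm (f x)) \<le> c" using c(2) by simp
  have "(\<lambda>y. norm (f y)) \<in> borel_measurable \<mu>" by measurable
  from integrable_u_bounded[OF t this nf] have nb: "AE x in \<mu>. \<bar>kernel_op \<mu> (u t) (\<lambda>y. norm (f y)) x\<bar> \<le> c * survival t x"
    by (auto elim: eventually_mono)
  define h where "h = kernel_op \<mu> (u t) (\<lambda>y. norm (f y))"
  have h_meas[measurable]: "h \<in> borel_measurable \<mu>" unfolding h_def by (rule meas_kernel_op[OF t]) simp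
  obtain b where b: "0 < b" "\<And>x. survival t x \<le> b" by (rule survival_bound[OF t]) blast
  have hb: "AE x in \<mu>. norm (h x) \<le> c * b"
    using nb
  proof eventually_elim
    fix x assume "\<bar>kernel_op \<mu> (u t) (\<lambda>y. norm (f y)) x\<bar> \<le> c * survival t x"
    moreover have "c * survival t x \<le> c * b" by (rule mult_left_mono[OF b(2) c(1)])
    ultimately show "norm (h x) \<le> c * b" unfolding h_def by simp
  qed
  have ih: "integrable \<mu> (\<lambda>x. \<psi> x * h x)"
  proof (rule Bochner_Integration.integrable_bound)
    show "integrable \<mu> (\<lambda>x. \<psi> x * (c * b))" using integrable_\<psi> by simp
    show "AE x in \<mu>. norm (\<psi> x * h x) \<le> norm (\<psi> x * (c * b))"
      using hb
    proof eventually_elim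
      fix x assume "norm (h x) \<le> c * b"
      then have "\<psi> x * norm (h x) \<le> \<psi> x * (c * b)" by (rule mult_left_mono[OF _ \<psi>_nonneg])
      then show "norm (\<psi> x * h x) \<le> norm (\<psi> x * (c * b))"
        using \<psi>_nonneg[of x] c(1) b(1) by (simp add: abs_mult)
    qed
  qed measurable
  have H: "integrable (\<mu> \<Otimes>\<^sub>M \<mu>) (case_prod ?H)"
  proof (rule pair.Fubini_integrable)
    have "AE x in \<mu>. \<psi> x * h x = (LINT y|\<mu>. norm (case_prod ?H (x, y)))"
      using nonneg[OF t]
    proof eventually_elim
      fix x assume n': "AE y in \<mu>. 0 \<le> u t x y"
      have "(LINT y|\<mu>. norm (case_prod ?H (x, y))) = (LINT y|\<mu>. \<psi> x * (\<bar>u t x y\<bar> * norm (f y)))"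
        using \<psi>_nonneg[of x] by (intro Bochner_Integration.integral_cong) (auto simp: abs_mult)
      also have "\<dots> = \<psi> x * (LINT y|\<mu>. \<bar>u t x y\<bar> * norm (f y))" by simp
      also have "(LINT y|\<mu>. \<bar>u t x y\<bar> * norm (f y)) = h x"
        unfolding h_def kernel_op_def
        using n' space_UNIV t by (intro integral_cong_AE) (auto elim: eventually_mono)
      finally show "\<psi> x * h x = (LINT y|\<mu>. norm (case_prod ?H (x, y)))" by simp
    qed
    then show "integrable \<mu> (\<lambda>x. LINT y|\<mu>. norm (case_prod ?H (x, y)))"
      by (rule integrable_cong_AE_imp[OF ih, rotated]) measurable
    show "AE x in \<mu>. integrable \<mu> (\<lambda>y. case_prod ?H (x, y))"
      using integrable_u_bounded[OF t _ c(2)] by (auto elim!: eventually_mono simp flip: scaleR_scaleR)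
  qed measurable
  have "(LINT x|\<mu>. \<psi> x *\<^sub>R Cb_op \<mu> (u t) f x) = (LINT x|\<mu>. \<psi> x *\<^sub>R kernel_op \<mu> (u t) f x)"
    using v(2) by (intro integral_cong_AE) (auto elim: eventually_mono)
  also have "\<dots> = (LINT x|\<mu>. (LINT y|\<mu>. ?H x y))"
    unfolding kernel_op_def by (simp flip: scaleR_scaleR)
  also have "\<dots> = (LINT y|\<mu>. (LINT x|\<mu>. ?H x y))" by (rule pair.Fubini_integral[OF H, symmetric])
  also have "\<dots> = (LINT y|\<mu>. exp (- l * t) *\<^sub>R (\<psi> y *\<^sub>R f y))"
  proof (rule integral_cong_AE)
    interpret adj: ergodic_kernel_semigroup \<mu> "adj_kernel u" \<psi> \<phi> l \<gamma> L C0 t0 t1 by (rule adjoint)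
    obtain d where d: "0 < d" "\<And>x. \<psi> x \<le> d" by (rule adj.\<phi>_bound) blast
    have "AE x in \<mu>. norm (\<psi> x) \<le> d" using d \<psi>_nonneg by simp
    note adj.integrable_u_bounded[OF t meas_\<psi> this]
    with adj_eigenfunction[OF t]
    show "AE y in \<mu>. (LINT x|\<mu>. ?H x y) = exp (- l * t) *\<^sub>R (\<psi> y *\<^sub>R f y)"
    proof eventually_elim
      fix y assume E: "kernel_op \<mu> (adj_kernel u t) \<psi> y = exp (- l * t) * \<psi> y"
        and "integrable \<mu> (\<lambda>x. adj_kernel u t y x *\<^sub>R \<psi> x) \<and> norm (kernel_op \<mu> (adj_kernel u t) \<psi> y) \<le> d * survival_adj t y"
      then have i: "integrable \<mu> (\<lambda>x. \<psi> x * u t x y)" by (simp add: adj_kernel_def mult.commute)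
      have "(LINT x|\<mu>. ?H x y) = (LINT x|\<mu>. \<psi> x * u t x y) *\<^sub>R f y"
        using i by simp
      also have "(LINT x|\<mu>. \<psi> x * u t x y) = exp (- l * t) * \<psi> y"
        using E unfolding kernel_op_def adj_kernel_def by (simp add: mult.commute)
      finally show "(LINT x|\<mu>. ?H x y) = exp (- l * t) *\<^sub>R (\<psi> y *\<^sub>R f y)" by simp
    qed
  qed (use t in measurable)
  also have "\<dots> = exp (- l * t) *\<^sub>R (LINT y|\<mu>. \<psi> y *\<^sub>R f y)" by (rule integral_scaleR_right)
  finally show ?thesis
    by (simp add: integral_qsd)
qed

lemma sets_qsd: "sets qsd = sets borel"
  unfolding normalized_measure_def by (simp add: borel)

lemma prob_space_qsd: "prob_space qsd"
proof
  let ?I = "LINT y|\<mu>. \<psi> y"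
  have "emeasure qsd (space qsd) = (\<integral>\<^sup>+y. ennreal (\<psi> y / ?I) \<partial>\<mu>)"
    unfolding normalized_measure_def by (subst emeasure_density) (auto intro!: nn_integral_cong)
  also have "\<dots> = ennreal (LINT y|\<mu>. \<psi> y / ?I)"
    using integrable_\<psi> \<psi>_nonneg integral_\<psi>_pos by (intro nn_integral_eq_integral) (auto intro: divide_nonneg_pos)
  also have "(LINT y|\<mu>. \<psi> y / ?I) = 1" using integral_\<psi>_pos by simp
  finally show "emeasure qsd (space qsd) = 1" by simp
qed

theorem quasi_stationary_qsd: "quasi_stationary \<mu> u qsd"
  unfolding quasi_stationary_def
proof (intro conjI allI impI)
  interpret qsd: prob_space qsd by (rule prob_space_qsd)
  fix t :: real and f :: "'a \<Rightarrow> complex" assume t: "0 < t" and f: "f \<in> Lp_space \<mu> \<infinity>"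
  have "(LINT x|qsd. Cb_op \<mu> (u t) (\<lambda>_. 1::complex) x) = complex_of_real (exp (- l * t))"
    using qsd_integral_invariant[OF t const_one_in_Linf] by (simp add: scaleR_conv_of_real qsd.prob_space)
  then have one: "(LINT x|qsd. survival t x) = exp (- l * t)"
    unfolding survival_complex[OF t] by (simp only: integral_complex_of_real of_real_eq_iff)
  then show "0 < (LINT x|qsd. survival t x)" by simp
  show "(LINT x|qsd. Cb_op \<mu> (u t) f x) / (LINT x|qsd. Cb_op \<mu> (u t) (\<lambda>_. 1) x) = (LINT x|qsd. f x)"
    unfolding qsd_integral_invariant[OF t f] survival_complex[OF t] integral_complex_of_real one
    by (simp add: scaleR_conv_of_real)
qed (rule prob_space_qsd sets_qsd)+

text \<open>
  Integrating the operator estimate against \<open>\<nu>\<close> shows that \<open>exp(l t) \<nu>(U\<^sub>t f)\<close> tends to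
  \<open>\<nu>(\<phi>) \<integral> \<psi> f / L\<close> for bounded \<open>f\<close>, and \<open>\<nu>(\<phi>) > 0\<close> since \<open>\<nu>\<close> charges \<open>{\<phi> > 0}\<close>. The quotient
  \<open>\<nu>(U\<^sub>t f) / \<nu>(U\<^sub>t 1)\<close> therefore tends to the normalized integral of \<open>f\<close>; being constant in \<open>t\<close>, it
  equals this limit.
\<close>

theorem quasi_stationary_unique:
  assumes q: "quasi_stationary \<mu> u \<nu>" and pos: "0 < measure \<nu> {x. 0 < \<phi> x}"
  shows "\<nu> = qsd"
proof -
  interpret \<nu>: prob_space \<nu> using q unfolding quasi_stationary_def by simp
  interpret qsd: prob_space qsd by (rule prob_space_qsd)
  have sets: "sets \<nu> = sets borel" using q unfolding quasi_stationary_def by simp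
  have meas: "g \<in> borel_measurable \<nu>" if "continuous_on UNIV g" for g :: "'a \<Rightarrow> 'b::topological_space"
    using borel_measurable_continuous_onI[OF that] measurable_cong_sets[OF sets refl, of "borel :: 'b measure"] by simp
  have int: "integrable \<nu> g" if cont: "continuous_on UNIV g" and bdd: "bounded (range g)"
    for g :: "'a \<Rightarrow> 'b::{banach,second_countable_topology}"
  proof -
    obtain c where "\<And>x. norm (g x) \<le> c" using bdd unfolding bounded_iff by auto
    then show ?thesis by (intro \<nu>.integrable_const_bound[of _ c]) (auto intro: meas[OF cont])
  qed
  define P where "P = (LINT x|\<nu>. \<phi> x)"
  have P: "0 < P"
  proof (rule ccontr)
    assume "\<not> 0 < P"
    moreover have "0 \<le> P" unfolding P_def using \<phi>_nonneg by (intro Bochner_Integration.integral_nonneg) auto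
    ultimately have "P = 0" by simp
    then have "AE x in \<nu>. \<phi> x = 0"
      using integral_nonneg_eq_0_iff_AE[OF int[OF \<phi>_cont \<phi>_bdd]] \<phi>_nonneg unfolding P_def by simp
    then have "AE x in \<nu>. x \<notin> {x. 0 < \<phi> x}" by eventually_elim simp
    then have "measure \<nu> {x. 0 < \<phi> x} = 0"
      using emeasure_eq_0_AE[of "\<lambda>x. 0 < \<phi> x" \<nu>] sets_eq_imp_space_eq[OF sets]
      by (simp add: measure_def)
    with pos show False by simp
  qed
  let ?I = "LINT y|\<mu>. \<psi> y"
  have decay: "((\<lambda>t. exp (- \<gamma> * t)) \<longlongrightarrow> 0) at_top"
  proof -
    have "filterlim (\<lambda>t. \<gamma> * t) at_top at_top"
      using \<gamma>_pos by (intro filterlim_tendsto_pos_mult_at_top[OF tendsto_const] filterlim_ident) auto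
    then have "filterlim (\<lambda>t. - (\<gamma> * t)) at_bot at_top" by (simp add: filterlim_uminus_at_top)
    then show ?thesis using filterlim_compose[OF exp_at_bot] by simp
  qed
  have lim: "((\<lambda>t. exp (l * t) *\<^sub>R (LINT x|\<nu>. Cb_op \<mu> (u t) f x)) \<longlongrightarrow> (P / L) *\<^sub>R (LINT y|\<mu>. \<psi> y *\<^sub>R f y)) at_top"
    if f: "f \<in> Lp_space \<mu> \<infinity>" for f :: "'a \<Rightarrow> complex"
  proof -
    obtain c where [measurable]: "f \<in> borel_measurable \<mu>" and c: "0 \<le> c" "AE x in \<mu>. norm (f x) \<le> c"
      using Linf_D[OF f] by blast
    have fint: "integrable \<mu> (\<lambda>y. survival_adj t1 y * norm (f y))"
    proof (rule Bochner_Integration.integrable_bound)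
      show "integrable \<mu> (\<lambda>y. survival_adj t1 y * c)" using integrable_survival_adj by simp
      show "AE y in \<mu>. norm (survival_adj t1 y * norm (f y)) \<le> norm (survival_adj t1 y * c)"
        using c(2) by eventually_elim (use c(1) in \<open>auto simp: abs_mult intro!: mult_left_mono\<close>)
    qed measurable
    let ?B = "LINT y|\<mu>. survival_adj t1 y * norm (f y)" and ?P = "LINT y|\<mu>. \<psi> y *\<^sub>R f y"
    let ?S = "LINT x|\<nu>. survival t1 x"
    have bound: "norm (exp (l * t) *\<^sub>R (LINT x|\<nu>. Cb_op \<mu> (u t) f x) - (P / L) *\<^sub>R ?P) \<le> error_const * ?S * ?B * exp (- \<gamma> * t)"
      if t: "5 * t1 < t" for t
    proof -
      have t_pos: "0 < t" using t t1_pos by simp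
      have v: "integrable \<nu> (Cb_op \<mu> (u t) f)"
        using Cb_op_Linf[OF t_pos f] int unfolding is_Cb_version_def by blast
      let ?d = "\<lambda>x. exp (l * t) *\<^sub>R Cb_op \<mu> (u t) f x - (\<phi> x / L) *\<^sub>R ?P"
      have i\<phi>: "integrable \<nu> \<phi>" by (rule int[OF \<phi>_cont \<phi>_bdd])
      have sint: "integrable \<nu> (survival t1)" by (rule int[OF survival_cont[OF t1_pos] survival_bdd[OF t1_pos]])
      have id: "integrable \<nu> ?d" using v i\<phi> by simp
      have eq: "exp (l * t) *\<^sub>R (LINT x|\<nu>. Cb_op \<mu> (u t) f x) - (P / L) *\<^sub>R ?P = (LINT x|\<nu>. ?d x)"
        using v i\<phi> unfolding P_def by simp
      have "norm (LINT x|\<nu>. ?d x) \<le> (LINT x|\<nu>. norm (?d x))" by (rule integral_norm_bound)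
      also have "\<dots> \<le> (LINT x|\<nu>. error_const * exp (- \<gamma> * t) * survival t1 x * ?B)"
        using operator_estimate[OF t _ fint] id sint by (intro integral_mono) auto
      also have "\<dots> = error_const * ?S * ?B * exp (- \<gamma> * t)"
        by simp
      finally show ?thesis unfolding eq .
    qed
    have "((\<lambda>t. error_const * ?S * ?B * exp (- \<gamma> * t)) \<longlongrightarrow> 0) at_top"
      by (rule tendsto_mult_right_zero[OF decay])
    then have "((\<lambda>t. exp (l * t) *\<^sub>R (LINT x|\<nu>. Cb_op \<mu> (u t) f x) - (P / L) *\<^sub>R ?P) \<longlongrightarrow> 0) at_top"
      by (rule Lim_null_comparison[rotated]) (rule eventually_mono[OF eventually_gt_at_top bound])
    then show ?thesis by (rule LIM_zero_cancel)
  qed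
  have eq: "(LINT x|\<nu>. f x) = (LINT x|qsd. f x)" if f: "f \<in> Lp_space \<mu> \<infinity>" for f :: "'a \<Rightarrow> complex"
  proof -
    have [measurable]: "f \<in> borel_measurable \<mu>" using f unfolding Lp_space_def by simp
    let ?P = "LINT y|\<mu>. \<psi> y *\<^sub>R f y"
    have l1: "((\<lambda>t. exp (l * t) *\<^sub>R (LINT x|\<nu>. Cb_op \<mu> (u t) (\<lambda>_. 1::complex) x)) \<longlongrightarrow> complex_of_real (P / L * ?I)) at_top"
      using lim[OF const_one_in_Linf] by (simp add: scaleR_conv_of_real)
    have ne: "complex_of_real (P / L * ?I) \<noteq> 0"
      using P L_pos integral_\<psi>_pos by simp
    have "((\<lambda>t. (exp (l * t) *\<^sub>R (LINT x|\<nu>. Cb_op \<mu> (u t) f x)) / (exp (l * t) *\<^sub>R (LINT x|\<nu>. Cb_op \<mu> (u t) (\<lambda>_. 1::complex) x)))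
      \<longlongrightarrow> ((P / L) *\<^sub>R ?P) / complex_of_real (P / L * ?I)) at_top"
      by (rule tendsto_divide[OF lim[OF f] l1 ne])
    moreover have "\<forall>\<^sub>F t in at_top. (exp (l * t) *\<^sub>R (LINT x|\<nu>. Cb_op \<mu> (u t) f x)) / (exp (l * t) *\<^sub>R (LINT x|\<nu>. Cb_op \<mu> (u t) (\<lambda>_. 1::complex) x))
      = (LINT x|\<nu>. f x)"
      using eventually_gt_at_top[of "0::real"]
    proof eventually_elim
      fix t :: real assume t: "0 < t"
      have "(LINT x|\<nu>. Cb_op \<mu> (u t) f x) / (LINT x|\<nu>. Cb_op \<mu> (u t) (\<lambda>_. 1::complex) x) = (LINT x|\<nu>. f x)"
        using q t f unfolding quasi_stationary_def by blast
      then show "(exp (l * t) *\<^sub>R (LINT x|\<nu>. Cb_op \<mu> (u t) f x)) / (exp (l * t) *\<^sub>R (LINT x|\<nu>. Cb_op \<mu> (u t) (\<lambda>_. 1::complex) x))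
        = (LINT x|\<nu>. f x)" by (simp add: scaleR_conv_of_real)
    qed
    ultimately have "((\<lambda>t::real. (LINT x|\<nu>. f x)) \<longlongrightarrow> ((P / L) *\<^sub>R ?P) / complex_of_real (P / L * ?I)) at_top"
      by (rule Lim_transform_eventually)
    then have "(LINT x|\<nu>. f x) = ((P / L) *\<^sub>R ?P) / complex_of_real (P / L * ?I)"
      by (intro tendsto_unique[OF _ tendsto_const]) auto
    also have "\<dots> = ?P /\<^sub>R ?I" using P L_pos by (simp add: scaleR_conv_of_real divide_simps)
    also have "\<dots> = (LINT x|qsd. f x)" by (simp add: integral_qsd)
    finally show ?thesis .
  qed
  show "\<nu> = qsd"
  proof (rule measure_eqI)
    show "sets \<nu> = sets qsd" using sets sets_qsd by simp
    fix A assume A: "A \<in> sets \<nu>"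
    then have A': "A \<in> sets \<mu>" "A \<in> sets qsd" using sets borel sets_qsd by auto
    let ?f = "\<lambda>x. complex_of_real (indicator A x)"
    have "?f \<in> Lp_space \<mu> \<infinity>"
      using A' by (intro Linf_I[where c = 1]) (auto simp: indicator_def)
    from eq[OF this] have "measure \<nu> A = measure qsd A"
      using A A' \<nu>.emeasure_finite by simp
    then show "emeasure \<nu> A = emeasure qsd A" by (simp add: \<nu>.emeasure_eq_measure qsd.emeasure_eq_measure)
  qed
qed

end

section \<open>Exponential quasi-ergodicity\<close>

text \<open>
  Cauchy-Schwarz in the form \<open>\<bar>a b\<bar> \<le> a\<^sup>2 + b\<^sup>2\<close> makes the product integrable; a Bochner integral of a
  non-integrable function would be \<open>0\<close>.
\<close>

lemma ground_states_overlap: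
  assumes borel: "sets \<mu> = sets borel" and supp: "full_support \<mu>"
    and "ground_state \<mu> v l \<phi>" and "ground_state \<mu> w l' \<psi>"
  shows "0 < (LINT x|\<mu>. \<phi> x * \<psi> x)"
proof -
  have L2: "integrable \<mu> (\<lambda>x. (h x)\<^sup>2)" and meas: "h \<in> borel_measurable \<mu>" if "ground_state \<mu> v l h" for v l h
  proof -
    have "(\<lambda>x. complex_of_real (h x)) \<in> Lp_space \<mu> 2" and "continuous_on UNIV h"
      using that unfolding ground_state_def neg_generator_def by auto
    then show "integrable \<mu> (\<lambda>x. (h x)\<^sup>2)" "h \<in> borel_measurable \<mu>"
      using borel_measurable_continuous_onI[of h] measurable_cong_sets[OF borel refl, of "borel :: real measure"]
      unfolding Lp_space_def by (simp_all add: powr_numeral)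
  qed
  have pos: "AE x in \<mu>. 0 < \<phi> x" "AE x in \<mu>. 0 < \<psi> x"
    using assms(3,4) unfolding ground_state_def by auto
  note [measurable] = meas[OF assms(3)] meas[OF assms(4)]
  have int: "integrable \<mu> (\<lambda>x. \<phi> x * \<psi> x)"
  proof (rule Bochner_Integration.integrable_bound)
    show "integrable \<mu> (\<lambda>x. (\<phi> x)\<^sup>2 + (\<psi> x)\<^sup>2)" using L2[OF assms(3)] L2[OF assms(4)] by simp
    have "norm (a * b) \<le> norm (a\<^sup>2 + b\<^sup>2)" for a b :: real
    proof -
      have "2 * \<bar>a * b\<bar> \<le> a\<^sup>2 + b\<^sup>2" using sum_squares_bound[of "\<bar>a\<bar>" "\<bar>b\<bar>"] by (simp add: abs_mult)
      then show ?thesis by simp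
    qed
    then show "AE x in \<mu>. norm (\<phi> x * \<psi> x) \<le> norm ((\<phi> x)\<^sup>2 + (\<psi> x)\<^sup>2)" by simp
  qed measurable
  have nn: "AE x in \<mu>. 0 \<le> \<phi> x * \<psi> x" using pos by eventually_elim simp
  show ?thesis
  proof (rule ccontr)
    assume "\<not> ?thesis"
    then have "(LINT x|\<mu>. \<phi> x * \<psi> x) = 0" using integral_nonneg_AE[OF nn] by simp
    then have "AE x in \<mu>. \<phi> x * \<psi> x = 0" using integral_nonneg_eq_0_iff_AE[OF int nn] by simp
    with pos have "AE x in \<mu>. False" by eventually_elim simp
    then show False using AE_closed_imp_everywhere[OF borel supp, of "\<lambda>_. False"] by simp
  qed
qed

lemma heat_content_finite_imp_integrable:
  fixes u :: "real \<Rightarrow> 'a::polish_space \<Rightarrow> 'a \<Rightarrow> real"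
  assumes borel: "sets \<mu> = sets borel" and supp: "full_support \<mu>" and sf: "sigma_finite_measure \<mu>"
    and meas: "(\<lambda>(x, y). u t x y) \<in> borel_measurable (\<mu> \<Otimes>\<^sub>M \<mu>)"
    and Feller: "strong_Feller \<mu> u" and t: "t > 0" and nonneg: "AE x in \<mu>. AE y in \<mu>. 0 \<le> u t x y"
    and heat: "heat_content \<mu> u t < \<infinity>"
  shows "integrable (\<mu> \<Otimes>\<^sub>M \<mu>) (\<lambda>(x, y). u t x y)"
proof -
  interpret sigma_finite_measure \<mu> by fact
  interpret pair: pair_sigma_finite \<mu> \<mu> by standard
  note one = strong_Feller_one[OF borel supp Feller t nonneg]
  note [measurable] = meas
  let ?a = "Cb_op \<mu> (u t) (\<lambda>_. 1::real)"
  have [measurable]: "?a \<in> borel_measurable \<mu>"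
    using borel_measurable_continuous_onI[OF one(1)] measurable_cong_sets[OF borel refl, of "borel :: real measure"] by simp
  have a: "integrable \<mu> ?a"
    using heat one(4) unfolding heat_content_def by (intro integrableI_nonneg) auto
  show ?thesis
  proof (rule pair.Fubini_integrable)
    have "AE x in \<mu>. ?a x = (LINT y|\<mu>. norm (case_prod (u t) (x, y)))"
      using one(3) nonneg AE_space
    proof eventually_elim
      fix x assume "?a x = (LINT y|\<mu>. u t x y)" and "AE y in \<mu>. 0 \<le> u t x y" and "x \<in> space \<mu>"
      then show "?a x = (LINT y|\<mu>. norm (case_prod (u t) (x, y)))"
        by (auto intro!: integral_cong_AE elim: eventually_mono)
    qed
    then show "integrable \<mu> (\<lambda>x. LINT y|\<mu>. norm (case_prod (u t) (x, y)))"
      by (rule integrable_cong_AE_imp[OF a, rotated]) measurable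
    show "AE x in \<mu>. integrable \<mu> (\<lambda>y. case_prod (u t) (x, y))"
      using strong_Feller_integrable[OF Feller t] by simp
  qed measurable
qed

theorem corollary3p5:
  fixes \<mu> :: "'a::polish_space measure"
    and u :: "real \<Rightarrow> 'a \<Rightarrow> 'a \<Rightarrow> real"
    and t0 t1 \<gamma> l0 \<Lambda> :: real
    and \<phi>0 \<psi>0 :: "'a \<Rightarrow> real"
    and N :: "'a set"
    and m ms :: "'a measure"
  assumes loc_compact: "locally_compact_space (euclidean :: 'a topology)"
    and borel: "sets \<mu> = sets borel"
    and loc_finite: "locally_finite_measure \<mu>"
    and full_supp: "full_support \<mu>"
    and kernel_meas: "\<And>t. t > 0 \<Longrightarrow> (\<lambda>(x, y). u t x y) \<in> borel_measurable (\<mu> \<Otimes>\<^sub>M \<mu>)"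
    and semigroup: "strongly_continuous_semigroup \<mu> u"
    and pos_preserving: "\<And>t. t > 0 \<Longrightarrow> positivity_preserving \<mu> (u t)"
    and adj_bounded: "\<And>t. t > 0 \<Longrightarrow> L2_bounded \<mu> (adj_kernel u t)"
    and adjoint: "\<And>t. t > 0 \<Longrightarrow> L2_adjoint \<mu> (u t) (adj_kernel u t)"
    and t0_pos: "t0 > 0"
    and compact_ops: "\<And>t. t > 0 \<Longrightarrow> L2_compact \<mu> (u t)"
    and pos_improving: "positivity_improving \<mu> (u t0)"
    and feller: "strong_Feller \<mu> u"
    and feller_adj: "strong_Feller \<mu> (adj_kernel u)"
    and ultra: "L2_Linf_bounded \<mu> (u t0)"
    and ultra_adj: "L2_Linf_bounded \<mu> (adj_kernel u t0)"
    and l0_def: "l0 = ground_energy \<mu> u"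
    and phi0: "ground_state \<mu> u l0 \<phi>0"
    and psi0: "ground_state \<mu> (adj_kernel u) l0 \<psi>0"
    and Lambda_def: "\<Lambda> = (LINT x|\<mu>. \<phi>0 x * \<psi>0 x)"
    and N_def: "N = {x. \<phi>0 x = 0} \<union> {x. \<psi>0 x = 0}"
    and gamma_pos: "\<gamma> > 0"
    and gamma_bound: "\<exists>C0>0. \<forall>t>2 * t0. AE (x, y) in \<mu> \<Otimes>\<^sub>M \<mu>.
          \<bar>exp (l0 * t) * u t x y - \<phi>0 x * \<psi>0 y / \<Lambda>\<bar> \<le> C0 * exp (- \<gamma> * t)"
    and t1_ge: "t1 \<ge> t0"
    and heat_finite: "heat_content \<mu> u t1 < \<infinity>"
    and m_def: "m = normalized_measure \<mu> \<psi>0"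
    and ms_def: "ms = normalized_measure \<mu> \<phi>0"
  shows
    "(\<forall>p::ennreal. p \<ge> 1 \<longrightarrow> (\<exists>C>0. \<forall>f::'a \<Rightarrow> complex. f \<in> Lp_space \<mu> p \<longrightarrow> Lp_norm \<mu> p f \<le> 1 \<longrightarrow>
        (\<forall>t>6 * t1. \<forall>x \<in> - N.
           norm (Cb_op \<mu> (u t) f x / Cb_op \<mu> (u t) (\<lambda>_. 1) x - (LINT y|m. f y))
             \<le> C * exp (- \<gamma> * t) * (Cb_op \<mu> (u t1) (\<lambda>_. 1) x / \<phi>0 x) \<and>
           norm (Cb_op \<mu> (adj_kernel u t) f x / Cb_op \<mu> (adj_kernel u t) (\<lambda>_. 1) x - (LINT y|ms. f y))
             \<le> C * exp (- \<gamma> * t) * (Cb_op \<mu> (adj_kernel u t1) (\<lambda>_. 1) x / \<psi>0 x))))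
     \<and> (quasi_stationary \<mu> u m \<and> quasi_stationary \<mu> (adj_kernel u) ms \<and>
        measure m (- N) * measure ms (- N) > 0 \<and>
        (\<forall>\<nu> \<nu>s. quasi_stationary \<mu> u \<nu> \<longrightarrow> quasi_stationary \<mu> (adj_kernel u) \<nu>s \<longrightarrow>
           measure \<nu> (- N) * measure \<nu>s (- N) > 0 \<longrightarrow> \<nu> = m \<and> \<nu>s = ms))
     \<and> (\<forall>p::ennreal. p \<ge> 1 \<longrightarrow> (\<forall>K. compact K \<longrightarrow> K \<subseteq> - N \<longrightarrow> (\<exists>C>0. \<forall>t>6 * t1.
          (SUP x\<in>K. SUP f\<in>{f::'a \<Rightarrow> complex. f \<in> Lp_space \<mu> p \<and> Lp_norm \<mu> p f \<le> 1}.
             ereal (norm (Cb_op \<mu> (u t) f x / Cb_op \<mu> (u t) (\<lambda>_. 1) x - (LINT y|m. f y))))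
             \<le> ereal (C * exp (- \<gamma> * t)) \<and>
          (SUP x\<in>K. SUP f\<in>{f::'a \<Rightarrow> complex. f \<in> Lp_space \<mu> p \<and> Lp_norm \<mu> p f \<le> 1}.
             ereal (norm (Cb_op \<mu> (adj_kernel u t) f x / Cb_op \<mu> (adj_kernel u t) (\<lambda>_. 1) x - (LINT y|ms. f y))))
             \<le> ereal (C * exp (- \<gamma> * t)))))"
proof -
  have sf: "sigma_finite_measure \<mu>" by (rule locally_finite_imp_sigma_finite[OF borel loc_finite])
  interpret sigma_finite_measure \<mu> by (rule sf)
  interpret pair: pair_sigma_finite \<mu> \<mu> by standard
  have nonneg: "AE x in \<mu>. AE y in \<mu>. 0 \<le> u t x y" if t: "t > 0" for t
    by (rule kernel_AE_nonneg[OF borel sf pos_preserving[OF t] strong_Feller_integrable[OF feller t]])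
  have composition: "AE x in \<mu>. AE y in \<mu>. integrable \<mu> (\<lambda>z. u s x z * u t z y) \<and> u (s + t) x y = (LINT z|\<mu>. u s x z * u t z y)"
    if s: "s > 0" and t: "t > 0" for s t
  proof -
    have st: "s + t > 0" using s t by simp
    have b: "L2_bounded \<mu> (u r)" if "r > 0" for r
      using semigroup that unfolding strongly_continuous_semigroup_def by blast
    have comp: "AE x in \<mu>. kernel_op \<mu> (u (s + t)) f x = kernel_op \<mu> (u s) (kernel_op \<mu> (u t) f) x"
      if "f \<in> Lp_space \<mu> 2" for f :: "'a \<Rightarrow> complex"
    proof -
      have "AE x in \<mu>. sg_op \<mu> u (s + t) f x = sg_op \<mu> u s (sg_op \<mu> u t f) x"
        using semigroup s t that unfolding strongly_continuous_semigroup_def by simp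
      then show ?thesis using s t st by (simp add: sg_op_def)
    qed
    note one = strong_Feller_one[OF borel full_supp feller st nonneg[OF st]]
    obtain C where C: "\<And>x. norm (Cb_op \<mu> (u (s + t)) (\<lambda>_. 1::real) x) \<le> C"
      using one(2) unfolding bounded_iff by auto
    have "AE x in \<mu>. (\<integral>\<^sup>+y. ennreal (u (s + t) x y) \<partial>\<mu>) \<le> ennreal C"
      using one(3) nonneg[OF st] strong_Feller_integrable[OF feller st]
    proof eventually_elim
      fix x assume "Cb_op \<mu> (u (s + t)) (\<lambda>_. 1::real) x = (LINT y|\<mu>. u (s + t) x y)"
        and "AE y in \<mu>. 0 \<le> u (s + t) x y" and "integrable \<mu> (u (s + t) x)"
      then show "(\<integral>\<^sup>+y. ennreal (u (s + t) x y) \<partial>\<mu>) \<le> ennreal C"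
        using C[of x] by (simp add: nn_integral_eq_integral ennreal_leI)
    qed
    from kernel_composition_AE[OF sf kernel_meas[OF s] kernel_meas[OF t] kernel_meas[OF st]
        nonneg[OF s] nonneg[OF t] nonneg[OF st] b[OF s] b[OF t] b[OF st] comp this]
    show ?thesis .
  qed
  obtain C0 where C0: "C0 > 0" "\<And>t. t > 2 * t0 \<Longrightarrow> AE (x, y) in \<mu> \<Otimes>\<^sub>M \<mu>.
      \<bar>exp (l0 * t) * u t x y - \<phi>0 x * \<psi>0 y / \<Lambda>\<bar> \<le> C0 * exp (- \<gamma> * t)"
    using gamma_bound by blast
  have t1_pos: "t1 > 0" using t0_pos t1_ge by simp
  have sg: "ergodic_kernel_semigroup \<mu> u \<phi>0 \<psi>0 l0 \<gamma> \<Lambda> C0 t0 t1"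
  proof (rule ergodic_kernel_semigroup.intro)
    show "0 < \<Lambda>" unfolding Lambda_def by (rule ground_states_overlap[OF borel full_supp phi0 psi0])
    show "AE x in \<mu>. AE y in \<mu>. \<bar>exp (l0 * t) * u t x y - \<phi>0 x * \<psi>0 y / \<Lambda>\<bar> \<le> C0 * exp (- \<gamma> * t)"
      if "2 * t0 < t" for t
      using pair.AE_pair[OF C0(2)[OF that]] by simp
    show "integrable (\<mu> \<Otimes>\<^sub>M \<mu>) (\<lambda>(x, y). u t1 x y)"
      by (rule heat_content_finite_imp_integrable[OF borel full_supp sf kernel_meas[OF t1_pos] feller t1_pos
            nonneg[OF t1_pos] heat_finite])
    show "continuous_on UNIV \<phi>0" "bounded (range \<phi>0)" "AE x in \<mu>. 0 < \<phi>0 x"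
      "continuous_on UNIV \<psi>0" "bounded (range \<psi>0)" "AE x in \<mu>. 0 < \<psi>0 x"
      using phi0 psi0 unfolding ground_state_def by auto
  qed (fact borel sf full_supp kernel_meas nonneg composition feller feller_adj gamma_pos C0(1) t0_pos t1_ge)+
  interpret fwd: ergodic_kernel_semigroup \<mu> u \<phi>0 \<psi>0 l0 \<gamma> \<Lambda> C0 t0 t1 by (rule sg)
  interpret bwd: ergodic_kernel_semigroup \<mu> "adj_kernel u" \<psi>0 \<phi>0 l0 \<gamma> \<Lambda> C0 t0 t1 by (rule fwd.adjoint)
  have pos: "0 < \<phi>0 x" "0 < \<psi>0 x" if "x \<in> - N" for x
    using that fwd.\<phi>_nonneg[of x] fwd.\<psi>_nonneg[of x] unfolding N_def by (auto simp: less_le)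
  have t6: "5 * t1 < t" if "6 * t1 < t" for t using that t1_pos by simp
  have N_closed: "closed N"
    unfolding N_def by (intro closed_Un closed_Collect_eq fwd.\<phi>_cont fwd.\<psi>_cont continuous_intros)
  show ?thesis
  proof (intro conjI allI impI)
    fix p :: ennreal assume p: "p \<ge> 1"
    let ?R1 = "\<lambda>C f t x. norm (Cb_op \<mu> (u t) (f::'a \<Rightarrow> complex) x / Cb_op \<mu> (u t) (\<lambda>_. 1) x - (LINT y|m. f y))
      \<le> C * exp (- \<gamma> * t) * (Cb_op \<mu> (u t1) (\<lambda>_. 1) x / \<phi>0 x)"
    let ?R2 = "\<lambda>C f t x. norm (Cb_op \<mu> (adj_kernel u t) (f::'a \<Rightarrow> complex) x / Cb_op \<mu> (adj_kernel u t) (\<lambda>_. 1) x - (LINT y|ms. f y))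
      \<le> C * exp (- \<gamma> * t) * (Cb_op \<mu> (adj_kernel u t1) (\<lambda>_. 1) x / \<psi>0 x)"
    obtain C1 where C1: "0 < C1" "\<forall>C\<ge>C1. \<forall>f. f \<in> Lp_space \<mu> p \<longrightarrow> Lp_norm \<mu> p f \<le> 1 \<longrightarrow>
        (\<forall>t>5 * t1. \<forall>x. 0 < \<phi>0 x \<longrightarrow> ?R1 C f t x)"
      using fwd.ratio_estimate[OF p, folded m_def] by (elim exE conjE)
    obtain C2 where C2: "0 < C2" "\<forall>C\<ge>C2. \<forall>f. f \<in> Lp_space \<mu> p \<longrightarrow> Lp_norm \<mu> p f \<le> 1 \<longrightarrow>
        (\<forall>t>5 * t1. \<forall>x. 0 < \<psi>0 x \<longrightarrow> ?R2 C f t x)"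
      using bwd.ratio_estimate[OF p, folded ms_def] by (elim exE conjE)
    show "\<exists>C>0. \<forall>f. f \<in> Lp_space \<mu> p \<longrightarrow> Lp_norm \<mu> p f \<le> 1 \<longrightarrow>
        (\<forall>t>6 * t1. \<forall>x \<in> - N. ?R1 C f t x \<and> ?R2 C f t x)"
    proof (intro exI[of _ "max C1 C2"] conjI allI impI ballI)
      show "0 < max C1 C2" using C1(1) by simp
      fix f :: "'a \<Rightarrow> complex" and t x
      assume f: "f \<in> Lp_space \<mu> p" "Lp_norm \<mu> p f \<le> 1" and t: "6 * t1 < t" and x: "x \<in> - N"
      show "?R1 (max C1 C2) f t x"
        by (rule C1(2)[rule_format, OF max.cobounded1 f t6[OF t] pos(1)[OF x]])
      show "?R2 (max C1 C2) f t x"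
        by (rule C2(2)[rule_format, OF max.cobounded2 f t6[OF t] pos(2)[OF x]])
    qed
  next
    show "quasi_stationary \<mu> u m" unfolding m_def by (rule fwd.quasi_stationary_qsd)
    show "quasi_stationary \<mu> (adj_kernel u) ms" unfolding ms_def by (rule bwd.quasi_stationary_qsd)
    have full: "measure (normalized_measure \<mu> h) (- N) = 1"
      if "prob_space (normalized_measure \<mu> h)" and [measurable]: "h \<in> borel_measurable \<mu>" for h
    proof -
      interpret P: prob_space "normalized_measure \<mu> h" by (rule that)
      have s: "sets (normalized_measure \<mu> h) = sets borel" unfolding normalized_measure_def by (simp add: borel)
      have "AE x in normalized_measure \<mu> h. x \<in> - N"
        unfolding normalized_measure_def
      proof (subst AE_density)
        show "AE x in \<mu>. 0 < ennreal (h x / (LINT y|\<mu>. h y)) \<longrightarrow> x \<in> - N"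
          using fwd.\<phi>_pos fwd.\<psi>_pos by eventually_elim (simp add: N_def)
      qed measurable
      moreover have "- N \<in> P.events" using N_closed s by auto
      ultimately show ?thesis by (simp add: P.prob_eq_1)
    qed
    have "measure m (- N) = 1" "measure ms (- N) = 1"
      unfolding m_def ms_def
      by (rule full[OF fwd.prob_space_qsd fwd.meas_\<psi>] full[OF bwd.prob_space_qsd bwd.meas_\<psi>])+
    then show "measure m (- N) * measure ms (- N) > 0" by simp
  next
    fix \<nu> \<nu>s
    assume q: "quasi_stationary \<mu> u \<nu>" "quasi_stationary \<mu> (adj_kernel u) \<nu>s"
      and "measure \<nu> (- N) * measure \<nu>s (- N) > 0"
    then have N: "measure \<nu> (- N) > 0" "measure \<nu>s (- N) > 0"
      using measure_nonneg[of \<nu> "- N"] measure_nonneg[of \<nu>s "- N"] by (auto simp: zero_less_mult_iff)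
    have mono: "measure \<eta> (- N) \<le> measure \<eta> {x. 0 < h x}"
      if "quasi_stationary \<mu> v \<eta>" "continuous_on UNIV h" "\<And>x. x \<in> - N \<Longrightarrow> 0 < h x" for v \<eta> and h :: "'a \<Rightarrow> real"
    proof -
      interpret \<eta>: prob_space \<eta> using that(1) unfolding quasi_stationary_def by simp
      have "open {x. 0 < h x}" by (intro open_Collect_less that(2) continuous_intros)
      then have "{x. 0 < h x} \<in> sets \<eta>" using that(1) unfolding quasi_stationary_def by simp
      then show ?thesis using that(3) by (intro \<eta>.finite_measure_mono) auto
    qed
    show "\<nu> = m" unfolding m_def
      by (rule fwd.quasi_stationary_unique[OF q(1)])
        (rule less_le_trans[OF N(1) mono[OF q(1) fwd.\<phi>_cont pos(1)]])
    show "\<nu>s = ms" unfolding ms_def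
      by (rule bwd.quasi_stationary_unique[OF q(2)])
        (rule less_le_trans[OF N(2) mono[OF q(2) fwd.\<psi>_cont pos(2)]])
  next
    fix p :: ennreal and K assume p: "p \<ge> 1" and K: "compact K" "K \<subseteq> - N"
    let ?F = "{f::'a \<Rightarrow> complex. f \<in> Lp_space \<mu> p \<and> Lp_norm \<mu> p f \<le> 1}"
    have posK: "K \<subseteq> {x. 0 < \<phi>0 x}" "K \<subseteq> {x. 0 < \<psi>0 x}" using pos K(2) by auto
    let ?R1 = "\<lambda>C t. (SUP x\<in>K. SUP f\<in>?F. ereal (norm (Cb_op \<mu> (u t) f x / Cb_op \<mu> (u t) (\<lambda>_. 1) x - (LINT y|m. f y))))
      \<le> ereal (C * exp (- \<gamma> * t))"
    let ?R2 = "\<lambda>C t. (SUP x\<in>K. SUP f\<in>?F. ereal (norm (Cb_op \<mu> (adj_kernel u t) f x / Cb_op \<mu> (adj_kernel u t) (\<lambda>_. 1) x - (LINT y|ms. f y))))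
      \<le> ereal (C * exp (- \<gamma> * t))"
    obtain C1 where C1: "0 < C1" "\<forall>C\<ge>C1. \<forall>t>5 * t1. ?R1 C t"
      using fwd.ratio_estimate_compact[OF p K(1) posK(1), folded m_def] by (elim exE conjE)
    obtain C2 where C2: "0 < C2" "\<forall>C\<ge>C2. \<forall>t>5 * t1. ?R2 C t"
      using bwd.ratio_estimate_compact[OF p K(1) posK(2), folded ms_def] by (elim exE conjE)
    show "\<exists>C>0. \<forall>t>6 * t1. ?R1 C t \<and> ?R2 C t"
    proof (intro exI[of _ "max C1 C2"] conjI allI impI)
      show "0 < max C1 C2" using C1(1) by simp
      fix t assume t: "6 * t1 < t"
      show "?R1 (max C1 C2) t" by (rule C1(2)[rule_format, OF max.cobounded1 t6[OF t]])
      show "?R2 (max C1 C2) t" by (rule C2(2)[rule_format, OF max.cobounded2 t6[OF t]])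
    qed
  qed
qed

end
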